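(* Let $r,m,n\ge 1$ be integers, and let $p_1,\dots,p_r$ and $g_1,\dots,g_m$ be SOS-convex polynomials on $\mathbb{R}^n$ such that $\mathcal F:=\{x\in\mathbb{R}^n : g_i(x)\le 0,\ i=1,\dots,m\}\neq\emptyset$. Let $\Delta:=\{\delta\in\mathbb{R}^r_+ : \sum_{j=1}^r\delta_j=1\}$, and let $d$ be the smallest even number such that $d\ge\max\{\max_{j}\deg p_j,\ \max_i\deg g_i\}$. Then the following statements are equivalent: (i) For every $x\in\mathbb{R}^n$, if $g_i(x)\le 0$ for all $i=1,\dots,m$, then $\max_{1\le j\le r}p_j(x)\ge 0$. (ii) For every $\varepsilon>0$ there exist $\bar\delta\in\Delta$, $\bar\lambda\in\mathbb{R}^m_+$ and $\bar\sigma\in\Sigma^2_d$ such that $\sum_{j=1}^r\bar\delta_j p_j+\sum_{i=1}^m\bar\lambda_i g_i+\varepsilon=\bar\sigma$ (as polynomials).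
   Context: $\mathbb{R}^k_+$ denotes the set of vectors in $\mathbb{R}^k$ with nonnegative coordinates. A real polynomial $f$ on $\mathbb{R}^n$ is a sum of squares if $f=\sum_{l=1}^s f_l^2$ for some real polynomials $f_1,\dots,f_s$; $\Sigma^2_d$ is the set of sum of squares real polynomials on $\mathbb{R}^n$ of degree at most $d$. A real polynomial $f$ on $\mathbb{R}^n$ is SOS-convex if its Hessian is an SOS-matrix polynomial, i.e. $\nabla^2 f(x)=H(x)H(x)^T$ for some $s\in\mathbb{N}$ and some matrix polynomial $H\in\mathbb{R}[x]^{n\times s}$. *)

theory Defs
  imports "HOL-Analysis.Analysis" "HOL-Library.Poly_Mapping"
begin

text \<open>
  Real polynomials on \<open>\<real>\<^sup>n\<close>, with \<open>n = CARD('n)\<close>: finitely supported maps from exponent vectors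
  to coefficients, under the convolution ring structure of \<open>Poly_Mapping\<close>.
  Equality on this type is equality of coefficients.
\<close>

type_synonym 'n rpoly = "('n \<Rightarrow>\<^sub>0 nat) \<Rightarrow>\<^sub>0 real"

definition const_rpoly :: "real \<Rightarrow> 'n rpoly" where
  "const_rpoly c = Poly_Mapping.single 0 c"

definition eval_rpoly :: "('n::finite) rpoly \<Rightarrow> real ^ 'n \<Rightarrow> real" where
  "eval_rpoly f x =
     (\<Sum>a\<in>Poly_Mapping.keys f. Poly_Mapping.lookup f a * (\<Prod>i\<in>UNIV. (x $ i) ^ Poly_Mapping.lookup a i))"

text \<open>Total degree; the zero polynomial is given degree \<open>0\<close>.\<close>

definition deg_rpoly :: "('n::finite) rpoly \<Rightarrow> nat" where
  "deg_rpoly f = Max (insert 0 ((\<lambda>a. \<Sum>i\<in>UNIV. Poly_Mapping.lookup a i) ` Poly_Mapping.keys f))"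

text \<open>
  The subtraction of exponents is truncated, but a monomial in which the variable \<open>i\<close> does not
  occur contributes the coefficient \<open>0\<close>.
\<close>

definition partial_rpoly :: "'n \<Rightarrow> 'n rpoly \<Rightarrow> 'n rpoly" where
  "partial_rpoly i f =
     (\<Sum>a\<in>Poly_Mapping.keys f.
        Poly_Mapping.single (a - Poly_Mapping.single i 1)
          (real (Poly_Mapping.lookup a i) * Poly_Mapping.lookup f a))"

definition hessian_rpoly :: "('n::finite) rpoly \<Rightarrow> 'n rpoly ^ 'n ^ 'n" where
  "hessian_rpoly f = (\<chi> i j. partial_rpoly i (partial_rpoly j f))"

text \<open>
  The number \<open>s\<close> of columns of \<open>H\<close> is existentially quantified, so \<open>H\<close> is given by its columns
  \<open>H 0, \<dots>, H (s - 1)\<close>; the right-hand side is \<open>H H\<^sup>T\<close>.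
\<close>

definition sos_matrix :: "('n::finite) rpoly ^ 'n ^ 'n \<Rightarrow> bool" where
  "sos_matrix M \<longleftrightarrow>
     (\<exists>(s::nat) (H :: nat \<Rightarrow> 'n rpoly ^ 'n). M = (\<chi> i j. \<Sum>l<s. H l $ i * H l $ j))"

definition sos_convex :: "('n::finite) rpoly \<Rightarrow> bool" where
  "sos_convex f \<longleftrightarrow> sos_matrix (hessian_rpoly f)"

definition sos :: "('n::finite) rpoly \<Rightarrow> bool" where
  "sos f \<longleftrightarrow> (\<exists>(s::nat) (h :: nat \<Rightarrow> 'n rpoly). f = (\<Sum>l<s. (h l)\<^sup>2))"

definition sos_deg_le :: "nat \<Rightarrow> ('n::finite) rpoly set" where
  "sos_deg_le d = {f. sos f \<and> deg_rpoly f \<le> d}"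

definition nonneg_orthant :: "(real ^ 'k) set" where
  "nonneg_orthant = {v. \<forall>i. 0 \<le> v $ i}"

definition unit_simplex :: "(real ^ ('k::finite)) set" where
  "unit_simplex = {v \<in> nonneg_orthant. (\<Sum>j\<in>UNIV. v $ j) = 1}"

end

theory Submission
  imports Defs "HOL-Computational_Algebra.Polynomial"
begin

text \<open>
  For convex polynomials the set of pairs \<open>(a, b)\<close> such that \<open>p\<^sub>j x \<le> a\<^sub>j\<close> and \<open>g\<^sub>i x \<le> b\<^sub>i\<close> for some
  \<open>x\<close> is closed: if the solutions of least norm of a convergent sequence of systems are unbounded,
  they have a recession direction, along which every polynomial in the system is affine with constant
  slope; the polynomials of negative slope can be dropped. Under (i) this set does not contain
  \<open>(-\<epsilon>, \<dots>, -\<epsilon>, 0)\<close>, and separation yields multipliers for which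
  \<open>L = \<Sum>\<^sub>j \<delta>\<^sub>j p\<^sub>j + \<Sum>\<^sub>i \<lambda>\<^sub>i g\<^sub>i + \<epsilon>\<close> is positive. By closedness for the single
  polynomial \<open>L\<close>, a minimiser \<open>a\<close> exists. Taylor expansion at \<open>a\<close> then shows that \<open>L\<close> is a sum of
  squares: if the Hessian is \<open>H H\<^sup>T\<close>, the remainder is the sum over the columns \<open>h\<close> of \<open>H\<close> of the
  integrals of \<open>(1 - t) (h(a + t (x - a)) \<bullet> (x - a))\<^sup>2\<close> over \<open>0 \<le> t \<le> 1\<close>, a positive semidefinite
  quadratic form in the coefficients of the powers of \<open>t\<close>.
\<close>

subsection \<open>Evaluation of polynomials\<close>

definition monom_eval :: "('n::finite \<Rightarrow>\<^sub>0 nat) \<Rightarrow> real ^ 'n \<Rightarrow> real" where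
  "monom_eval a x = (\<Prod>i\<in>UNIV. (x $ i) ^ Poly_Mapping.lookup a i)"

lemma monom_eval_zero [simp]: "monom_eval 0 x = 1"
  by (simp add: monom_eval_def)

lemma monom_eval_add: "monom_eval (a + b) x = monom_eval a x * monom_eval b x"
  by (simp add: monom_eval_def lookup_add power_add prod.distrib)

lemma eval_rpoly_superset:
  assumes "finite A" "Poly_Mapping.keys f \<subseteq> A"
  shows "eval_rpoly f x = (\<Sum>a\<in>A. Poly_Mapping.lookup f a * monom_eval a x)"
  unfolding eval_rpoly_def monom_eval_def
  by (rule sum.mono_neutral_left) (use assms in \<open>auto simp: in_keys_iff\<close>)

lemma eval_rpoly_zero [simp]: "eval_rpoly 0 x = 0"
  by (simp add: eval_rpoly_def)

lemma eval_rpoly_single [simp]: "eval_rpoly (Poly_Mapping.single a c) x = c * monom_eval a x"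
  by (subst eval_rpoly_superset[of "{a}"]) auto

lemma eval_rpoly_add [simp]: "eval_rpoly (f + g) x = eval_rpoly f x + eval_rpoly g x"
proof -
  let ?A = "Poly_Mapping.keys f \<union> Poly_Mapping.keys g"
  have "Poly_Mapping.keys (f + g) \<subseteq> ?A"
    by (rule Poly_Mapping.keys_add)
  then show ?thesis
    by (simp add: eval_rpoly_superset[of ?A] lookup_add distrib_right sum.distrib)
qed

lemma eval_rpoly_sum [simp]: "eval_rpoly (sum f A) x = (\<Sum>a\<in>A. eval_rpoly (f a) x)"
  by (induction A rule: infinite_finite_induct) auto

lemma rpoly_sum_single:
  fixes f :: "('n::finite) rpoly"
  shows "f = (\<Sum>a\<in>Poly_Mapping.keys f. Poly_Mapping.single a (Poly_Mapping.lookup f a))"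
  by (rule poly_mapping_eqI) (auto simp: lookup_sum lookup_single when_def in_keys_iff)

lemma eval_rpoly_mult [simp]: "eval_rpoly (f * g) x = eval_rpoly f x * eval_rpoly g x"
proof -
  have "f * g = (\<Sum>a\<in>Poly_Mapping.keys f. \<Sum>b\<in>Poly_Mapping.keys g.
      Poly_Mapping.single (a + b) (Poly_Mapping.lookup f a * Poly_Mapping.lookup g b))"
    by (subst rpoly_sum_single[of f], subst rpoly_sum_single[of g])
       (simp add: sum_product mult_single)
  then have "eval_rpoly (f * g) x = (\<Sum>a\<in>Poly_Mapping.keys f. \<Sum>b\<in>Poly_Mapping.keys g.
      Poly_Mapping.lookup f a * Poly_Mapping.lookup g b * monom_eval (a + b) x)"
    by simp
  also have "\<dots> = eval_rpoly f x * eval_rpoly g x"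
    unfolding eval_rpoly_superset[OF finite_keys order_refl] sum_product
    by (intro sum.cong refl) (simp add: monom_eval_add)
  finally show ?thesis .
qed

lemma eval_rpoly_const [simp]: "eval_rpoly (const_rpoly c) x = c"
  by (simp add: const_rpoly_def)

lemma eval_rpoly_one [simp]: "eval_rpoly 1 x = 1"
  using eval_rpoly_const[of 1 x] by (simp add: const_rpoly_def)

lemma eval_rpoly_minus [simp]: "eval_rpoly (f - g) x = eval_rpoly f x - eval_rpoly g x"
  using eval_rpoly_add[of "f - g" g x] by simp

lemma eval_rpoly_power [simp]: "eval_rpoly (f ^ k) x = eval_rpoly f x ^ k"
  by (induction k) auto

lemma eval_rpoly_prod [simp]: "eval_rpoly (prod f A) x = (\<Prod>a\<in>A. eval_rpoly (f a) x)"
  by (induction A rule: infinite_finite_induct) auto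

lemma const_rpoly_mult: "const_rpoly (a * b) = const_rpoly a * const_rpoly b"
  by (simp add: const_rpoly_def mult_single)

lemma const_rpoly_0 [simp]: "const_rpoly 0 = 0"
  by (simp add: const_rpoly_def)

definition var_rpoly :: "'n \<Rightarrow> 'n rpoly" where
  "var_rpoly i = Poly_Mapping.single (Poly_Mapping.single i 1) 1"

lemma eval_rpoly_var [simp]: "eval_rpoly (var_rpoly i) x = x $ i"
proof -
  have "monom_eval (Poly_Mapping.single i 1) x = (\<Prod>j\<in>UNIV. if j = i then x $ i else 1)"
    unfolding monom_eval_def by (rule prod.cong) (auto simp: lookup_single when_def)
  then show ?thesis
    by (simp add: var_rpoly_def)
qed

section \<open>Formal partial derivatives and derivatives along lines\<close>

lemma lookup_partial_rpoly:
  "Poly_Mapping.lookup (partial_rpoly i f) b =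
     real (Poly_Mapping.lookup b i + 1) * Poly_Mapping.lookup f (b + Poly_Mapping.single i 1)"
proof -
  let ?e = "Poly_Mapping.single i (1::nat)"
  \<comment> \<open>Truncated subtraction also sends \<open>b\<close> to itself when the variable
    \<open>i\<close> does not occur in \<open>b\<close>, but such an exponent carries the factor 0.
    Among the others \<open>b + ?e\<close> is the only preimage of \<open>b\<close>.\<close>
  have eq: "a = b + ?e" if "a - ?e = b" "Poly_Mapping.lookup a i \<noteq> 0" for a
  proof (rule poly_mapping_eqI)
    fix k show "Poly_Mapping.lookup a k = Poly_Mapping.lookup (b + ?e) k"
      using that by (auto simp: lookup_add lookup_minus lookup_single when_def)
  qed
  have "Poly_Mapping.lookup (partial_rpoly i f) b =
      (\<Sum>a\<in>Poly_Mapping.keys f. if a = b + ?e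
         then real (Poly_Mapping.lookup a i) * Poly_Mapping.lookup f a else 0)"
    unfolding partial_rpoly_def lookup_sum
    by (rule sum.cong) (use eq in \<open>auto simp: lookup_single when_def\<close>)
  then show ?thesis
    by (auto simp: lookup_add in_keys_iff)
qed

lemma monom_eval_line_derivative:
  fixes a w :: "real ^ 'n::finite"
  shows "((\<lambda>t. monom_eval b (a + t *\<^sub>R w)) has_real_derivative
    (\<Sum>i\<in>UNIV. w $ i * (real (Poly_Mapping.lookup b i) *
       monom_eval (b - Poly_Mapping.single i 1) (a + t *\<^sub>R w)))) (at t)"
proof -
  \<comment> \<open>Both sides truncate in the same way, so this covers exponent 0 at
    \<open>i\<close> as well; the factor \<open>real (Poly_Mapping.lookup b i)\<close> then
    annihilates that summand of the product rule.\<close>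
  have shift: "monom_eval (b - Poly_Mapping.single i 1) y =
      y $ i ^ (Poly_Mapping.lookup b i - 1) * (\<Prod>j\<in>UNIV - {i}. y $ j ^ Poly_Mapping.lookup b j)"
    for i and y :: "real ^ 'n"
  proof -
    have "monom_eval (b - Poly_Mapping.single i 1) y =
        y $ i ^ (Poly_Mapping.lookup b i - 1) *
        (\<Prod>j\<in>UNIV - {i}. y $ j ^ Poly_Mapping.lookup (b - Poly_Mapping.single i 1) j)"
      unfolding monom_eval_def by (subst prod.remove[of _ i]) (auto simp: lookup_minus)
    also have "(\<Prod>j\<in>UNIV - {i}. y $ j ^ Poly_Mapping.lookup (b - Poly_Mapping.single i 1) j)
        = (\<Prod>j\<in>UNIV - {i}. y $ j ^ Poly_Mapping.lookup b j)"
      by (rule prod.cong) (auto simp: lookup_minus lookup_single when_def)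
    finally show ?thesis .
  qed
  have "((\<lambda>t. \<Prod>i\<in>UNIV. (a $ i + t * w $ i) ^ Poly_Mapping.lookup b i) has_real_derivative
    (\<Sum>i\<in>UNIV. (real (Poly_Mapping.lookup b i) * (a $ i + t * w $ i) ^ (Poly_Mapping.lookup b i - 1)
        * w $ i) * (\<Prod>j\<in>UNIV - {i}. (a $ j + t * w $ j) ^ Poly_Mapping.lookup b j))) (at t)"
    by (rule has_field_derivative_prod) (auto intro!: derivative_eq_intros)
  then show ?thesis
    unfolding shift by (simp add: monom_eval_def mult_ac)
qed

lemma eval_rpoly_line_derivative:
  fixes a w :: "real ^ 'n::finite"
  shows "((\<lambda>t. eval_rpoly f (a + t *\<^sub>R w)) has_real_derivative
    (\<Sum>i\<in>UNIV. w $ i * eval_rpoly (partial_rpoly i f) (a + t *\<^sub>R w))) (at t)"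
proof -
  have "((\<lambda>t. \<Sum>b\<in>Poly_Mapping.keys f. Poly_Mapping.lookup f b * monom_eval b (a + t *\<^sub>R w))
    has_real_derivative (\<Sum>b\<in>Poly_Mapping.keys f. Poly_Mapping.lookup f b *
     (\<Sum>i\<in>UNIV. w $ i * (real (Poly_Mapping.lookup b i) *
       monom_eval (b - Poly_Mapping.single i 1) (a + t *\<^sub>R w))))) (at t)"
    by (intro DERIV_sum DERIV_cmult monom_eval_line_derivative)
  moreover have "(\<Sum>b\<in>Poly_Mapping.keys f. Poly_Mapping.lookup f b *
     (\<Sum>i\<in>UNIV. w $ i * (real (Poly_Mapping.lookup b i) *
       monom_eval (b - Poly_Mapping.single i 1) (a + t *\<^sub>R w)))) =
     (\<Sum>i\<in>UNIV. w $ i * eval_rpoly (partial_rpoly i f) (a + t *\<^sub>R w))"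
    unfolding partial_rpoly_def
    by (simp add: sum_distrib_left mult_ac) (rule sum.swap)
  ultimately show ?thesis
    by (simp add: eval_rpoly_superset[OF finite_keys order_refl])
qed

text \<open>Induction on the total degree of an exponent. The constant coefficient is the value at
  the origin. The formal partial derivatives of \<open>f\<close> vanish as functions too, and a
  coefficient of degree \<open>k + 1\<close> is, up to a nonzero factor, one of degree
  \<open>k\<close> in a partial derivative. Polynomial identities can therefore be checked
  pointwise.\<close>

lemma eval_rpoly_eq_zero_imp:
  fixes f :: "('n::finite) rpoly"
  assumes "\<And>x. eval_rpoly f x = 0"
  shows "f = 0"
proof -
  have "Poly_Mapping.lookup f b = 0" if "(\<Sum>i\<in>UNIV. Poly_Mapping.lookup b i) = k" for b k
    using assms that
  proof (induction k arbitrary: f b)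
    case 0
    then have b: "b = 0"
      by (intro poly_mapping_eqI) auto
    have "monom_eval a 0 = 0" if a: "a \<noteq> 0" for a :: "'n \<Rightarrow>\<^sub>0 nat"
    proof -
      obtain i where "Poly_Mapping.lookup a i \<noteq> 0"
        using a poly_mapping_eqI[of a 0] by auto
      then show ?thesis
        by (auto simp: monom_eval_def power_0_left intro!: prod_zero)
    qed
    then have "eval_rpoly f 0 = (\<Sum>a\<in>Poly_Mapping.keys f.
        if a = 0 then Poly_Mapping.lookup f a else 0)"
      unfolding eval_rpoly_superset[OF finite_keys order_refl] by (intro sum.cong) auto
    also have "\<dots> = Poly_Mapping.lookup f 0"
      by (simp add: in_keys_iff)
    finally show ?case
      using 0 b by simp
  next
    case (Suc k)
    then obtain i where i: "Poly_Mapping.lookup b i \<noteq> 0"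
      by (metis Zero_not_Suc sum.neutral)
    define c where "c = b - Poly_Mapping.single i 1"
    have b: "b = c + Poly_Mapping.single i 1"
      by (rule poly_mapping_eqI)
         (use i in \<open>auto simp: c_def lookup_add lookup_minus lookup_single when_def\<close>)
    have "eval_rpoly (partial_rpoly i f) x = 0" for x
    proof -
      have "((\<lambda>t. eval_rpoly f (x + t *\<^sub>R axis i 1)) has_real_derivative
          eval_rpoly (partial_rpoly i f) x) (at 0)"
        using eval_rpoly_line_derivative[of f x "axis i 1" 0]
        by (simp add: axis_def if_distrib[of "\<lambda>u. u * _"] cong: if_cong)
      then show ?thesis
        using Suc.prems(1) by (simp add: DERIV_unique[OF _ DERIV_const])
    qed
    moreover have "(\<Sum>j\<in>UNIV. Poly_Mapping.lookup c j) = k"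
    proof -
      have "(\<Sum>j\<in>UNIV. Poly_Mapping.lookup (Poly_Mapping.single i (1::nat)) j) = 1"
        by (simp add: lookup_single when_def)
      then show ?thesis
        using Suc.prems(2) unfolding b lookup_add sum.distrib by simp
    qed
    ultimately have "Poly_Mapping.lookup (partial_rpoly i f) c = 0"
      by (rule Suc.IH)
    then show ?case
      by (simp add: lookup_partial_rpoly b)
  qed
  then show ?thesis
    by (intro poly_mapping_eqI) auto
qed

lemma eval_rpoly_inject:
  fixes f g :: "('n::finite) rpoly"
  assumes "\<And>x. eval_rpoly f x = eval_rpoly g x"
  shows "f = g"
  using eval_rpoly_eq_zero_imp[of "f - g"] assms by simp

text \<open>Makes the results on convex polynomial functions over a Euclidean space
  applicable.\<close>

lemma real_polynomial_function_eval_rpoly: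
  fixes f :: "('n::finite) rpoly"
  shows "real_polynomial_function (eval_rpoly f)"
proof -
  have "bounded_linear (\<lambda>x::real^'n. x $ i)" for i :: 'n
    by (rule bounded_linear_vec_nth)
  then show ?thesis
    unfolding eval_rpoly_def[abs_def]
    by (intro real_polynomial_function_sum real_polynomial_function_prod
        real_polynomial_function.intros(2,4) real_polynomial_function_power
        real_polynomial_function.intros(1)) auto
qed

subsection \<open>Sums of squares\<close>

lemma sos_zero: "sos 0"
  unfolding sos_def by (rule exI[of _ 0]) auto

lemma sos_square: "sos (h\<^sup>2)"
  unfolding sos_def by (rule exI[of _ 1], rule exI[of _ "\<lambda>_. h"]) simp

lemma sos_add:
  assumes "sos f" "sos g"
  shows "sos (f + g)"
proof -
  obtain s :: nat and h where f: "f = (\<Sum>l<s. (h l)\<^sup>2)"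
    using assms(1) unfolding sos_def by blast
  obtain s' :: nat and h' where g: "g = (\<Sum>l<s'. (h' l)\<^sup>2)"
    using assms(2) unfolding sos_def by blast
  have "(\<Sum>l<s + s'. (if l < s then h l else h' (l - s))\<^sup>2)
      = (\<Sum>l<s. (h l)\<^sup>2) + (\<Sum>l\<in>{s..<s + s'}. (h' (l - s))\<^sup>2)"
    unfolding lessThan_atLeast0
    by (subst sum.atLeastLessThan_concat[symmetric, of 0 s "s + s'"]) auto
  also have "(\<Sum>l\<in>{s..<s + s'}. (h' (l - s))\<^sup>2) = g"
    unfolding g by (rule sum.reindex_bij_witness[of _ "\<lambda>l. l + s" "\<lambda>l. l - s"]) auto
  finally have "f + g = (\<Sum>l<s + s'. (if l < s then h l else h' (l - s))\<^sup>2)"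
    by (simp only: f)
  then show ?thesis
    unfolding sos_def by (intro exI)
qed

lemma sos_sum: "(\<And>a. a \<in> A \<Longrightarrow> sos (f a)) \<Longrightarrow> sos (\<Sum>a\<in>A. f a)"
  by (induction A rule: infinite_finite_induct) (auto intro: sos_zero sos_add)

lemma sos_const: "c \<ge> 0 \<Longrightarrow> sos (const_rpoly c)"
  using sos_square[of "const_rpoly (sqrt c)"]
  by (simp add: power2_eq_square flip: const_rpoly_mult)

lemma sos_const_mult:
  assumes "c \<ge> 0" "sos f"
  shows "sos (const_rpoly c * f)"
proof -
  obtain s :: nat and h where f: "f = (\<Sum>l<s. (h l)\<^sup>2)"
    using assms(2) unfolding sos_def by blast
  have c: "const_rpoly c = (const_rpoly (sqrt c))\<^sup>2"
    using assms(1) by (simp add: power2_eq_square flip: const_rpoly_mult)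
  show ?thesis
    unfolding f sum_distrib_left c power_mult_distrib[symmetric] by (intro sos_sum sos_square)
qed

lemma sos_nonneg: "sos f \<Longrightarrow> eval_rpoly f x \<ge> 0"
  by (auto simp: sos_def intro!: sum_nonneg)

text \<open>Completing the square, as in a Cholesky factorisation.\<close>

lemma sos_psd_quadratic_form:
  fixes M :: "nat \<Rightarrow> nat \<Rightarrow> real" and u :: "nat \<Rightarrow> ('n::finite) rpoly"
  assumes sym: "\<And>i j. M i j = M j i"
    and psd: "\<And>c. (\<Sum>i<N. \<Sum>j<N. M i j * c i * c j) \<ge> 0"
  shows "sos (\<Sum>i<N. \<Sum>j<N. const_rpoly (M i j) * u i * u j)"
  using assms
proof (induction N arbitrary: M)
  case 0
  then show ?case by (simp add: sos_zero)
next
  case (Suc N)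
  note sym = Suc.prems(1) and psd = Suc.prems(2)
  let ?m = "M N N"
  have split: "(\<Sum>i<Suc N. \<Sum>j<Suc N. f i j) =
      (\<Sum>i<N. \<Sum>j<N. f i j) + (\<Sum>i<N. f i N) + (\<Sum>j<N. f N j) + f N N"
    for f :: "nat \<Rightarrow> nat \<Rightarrow> 'b::comm_monoid_add"
    by (simp add: sum.distrib ac_simps)
  \<comment> \<open>The form at the vector \<open>c\<close> extended by a last entry
    \<open>z\<close>, read as a quadratic polynomial in \<open>z\<close>.\<close>
  have quad: "(\<Sum>i<N. \<Sum>j<N. M i j * c i * c j) + 2 * z * (\<Sum>i<N. M i N * c i) + ?m * z\<^sup>2 \<ge> 0" for c z
  proof -
    have "(\<Sum>i<Suc N. \<Sum>j<Suc N. M i j * (c(N := z)) i * (c(N := z)) j)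
        = (\<Sum>i<N. \<Sum>j<N. M i j * c i * c j) + 2 * z * (\<Sum>i<N. M i N * c i) + ?m * z\<^sup>2"
    proof -
      have "(\<Sum>i<N. M i N * c i * z) = z * (\<Sum>i<N. M i N * c i)"
        "(\<Sum>j<N. M N j * z * c j) = z * (\<Sum>i<N. M i N * c i)"
        by (simp_all add: sum_distrib_left sym mult_ac)
      then show ?thesis
        unfolding split by (simp add: power2_eq_square)
    qed
    then show ?thesis
      using psd[of "c(N := z)"] by simp
  qed
  have m: "?m \<ge> 0"
    using quad[of "\<lambda>_. 0" 1] by simp
  show ?case
  proof (cases "?m = 0")
    case True
    \<comment> \<open>With a zero pivot the expression in \<open>quad\<close> is affine in
      \<open>z\<close>, so nonnegativity for all \<open>z\<close> forces slope 0. For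
      \<open>c\<close> the \<open>k\<close>-th unit vector this slope is
      \<open>2 * M k N\<close>.\<close>
    have zero: "M k N = 0" if k: "k < N" for k
    proof (rule ccontr)
      assume nz: "M k N \<noteq> 0"
      define c where "c i = (if i = k then 1 else 0 :: real)" for i
      have "(\<Sum>i<N. M i N * c i) = M k N"
        using k by (simp add: c_def if_distrib[of "\<lambda>y. _ * y"] cong: if_cong)
      moreover have "(\<Sum>i<N. \<Sum>j<N. M i j * c i * c j) = M k k"
        using k by (simp add: c_def if_distrib[of "\<lambda>y. _ * y"] if_distrib[of "\<lambda>y. y * _"] cong: if_cong)
      ultimately have "M k k + 2 * z * M k N \<ge> 0" for z
        using quad[of c z] True by simp
      \<comment> \<open>At this \<open>z\<close> the form would take the value -1.\<close>
      moreover have "2 * (- (M k k + 1) / (2 * M k N)) * M k N = - (M k k + 1)"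
        using nz by simp
      ultimately have "M k k + - (M k k + 1) \<ge> 0"
        by metis
      then show False
        by simp
    qed
    have "sos (\<Sum>i<N. \<Sum>j<N. const_rpoly (M i j) * u i * u j)"
      using Suc.IH[of M] sym quad[of _ 0] by simp
    then show ?thesis
      unfolding split using zero True sym by simp
  next
    case False
    then have m: "?m > 0"
      using m by simp
    \<comment> \<open>\<open>S\<close> is the Schur complement of the pivot; \<open>w\<close> is the
      linear form whose square absorbs the last row and column.\<close>
    define S where "S i j = M i j - M i N * M j N / ?m" for i j
    define w where "w = u N + (\<Sum>i<N. const_rpoly (M i N / ?m) * u i)"
    have "(\<Sum>i<N. \<Sum>j<N. S i j * c i * c j) \<ge> 0" for c
    proof -
      define b where "b = (\<Sum>i<N. M i N * c i)"
      have "(\<Sum>i<N. \<Sum>j<N. (M i N * M j N / ?m) * c i * c j) = b\<^sup>2 / ?m"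
        by (simp add: b_def power2_eq_square sum_product sum_divide_distrib mult_ac)
      then have "(\<Sum>i<N. \<Sum>j<N. S i j * c i * c j) = (\<Sum>i<N. \<Sum>j<N. M i j * c i * c j) - b\<^sup>2 / ?m"
        by (simp add: S_def left_diff_distrib sum_subtractf)
      \<comment> \<open>The quadratic in \<open>quad\<close> is minimal at
        \<open>z = - b / ?m\<close>, and its minimum is the form of \<open>S\<close> at
        \<open>c\<close>.\<close>
      moreover have "2 * (- b / ?m) * b + ?m * (- b / ?m)\<^sup>2 = - (b\<^sup>2 / ?m)"
        using m by (simp add: field_simps power2_eq_square)
      ultimately show ?thesis
        using quad[of c "- b / ?m"] by (simp flip: b_def)
    qed
    then have "sos (\<Sum>i<N. \<Sum>j<N. const_rpoly (S i j) * u i * u j)"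
      by (intro Suc.IH) (simp_all add: S_def sym mult.commute)
    moreover have "sos (const_rpoly ?m * w\<^sup>2)"
      using m by (intro sos_const_mult sos_square) simp
    moreover have "(\<Sum>i<Suc N. \<Sum>j<Suc N. const_rpoly (M i j) * u i * u j) =
        (\<Sum>i<N. \<Sum>j<N. const_rpoly (S i j) * u i * u j) + const_rpoly ?m * w\<^sup>2"
    proof (rule eval_rpoly_inject)
      fix x :: "real ^ 'n"
      define b where "b = (\<Sum>i<N. M i N * eval_rpoly (u i) x)"
      have "(\<Sum>i<N. \<Sum>j<N. (M i N * M j N / ?m) * eval_rpoly (u i) x * eval_rpoly (u j) x) = b\<^sup>2 / ?m"
        by (simp add: b_def power2_eq_square sum_product sum_divide_distrib mult_ac)
      then have 1: "(\<Sum>i<N. \<Sum>j<N. S i j * eval_rpoly (u i) x * eval_rpoly (u j) x)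
          = (\<Sum>i<N. \<Sum>j<N. M i j * eval_rpoly (u i) x * eval_rpoly (u j) x) - b\<^sup>2 / ?m"
        by (simp add: S_def left_diff_distrib sum_subtractf)
      have 2: "eval_rpoly w x = eval_rpoly (u N) x + b / ?m"
        by (simp add: w_def b_def sum_divide_distrib)
      have 3: "(\<Sum>i<N. M i N * eval_rpoly (u i) x * eval_rpoly (u N) x) = b * eval_rpoly (u N) x"
        "(\<Sum>i<N. M N i * eval_rpoly (u N) x * eval_rpoly (u i) x) = b * eval_rpoly (u N) x"
        by (simp_all add: b_def sum_distrib_left sym mult_ac)
      show "eval_rpoly (\<Sum>i<Suc N. \<Sum>j<Suc N. const_rpoly (M i j) * u i * u j) x =
        eval_rpoly ((\<Sum>i<N. \<Sum>j<N. const_rpoly (S i j) * u i * u j) + const_rpoly ?m * w\<^sup>2) x"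
        unfolding split using m
        by (simp add: 1 2 3) (simp add: field_simps power2_eq_square)
    qed
    ultimately show ?thesis
      by (simp add: sos_add)
  qed
qed


section \<open>Taylor's formula with the remainder of a sum of squares\<close>

lemma DERIV_square_double_sum:
  fixes c :: "nat \<Rightarrow> real"
  shows "((\<lambda>t. \<Sum>i<N. \<Sum>j<N. c i * c j * t ^ (i + j + 1) / real (i + j + 1)) has_real_derivative
      (\<Sum>i<N. c i * t ^ i)\<^sup>2) (at t)"
    and "((\<lambda>t. \<Sum>i<N. \<Sum>j<N. c i * c j * t ^ (i + j + 2) / real ((i + j + 1) * (i + j + 2)))
      has_real_derivative (\<Sum>i<N. \<Sum>j<N. c i * c j * t ^ (i + j + 1) / real (i + j + 1))) (at t)"
proof -
  \<comment> \<open>\<open>D\<close> is the denominator left by the previous integration: 1 for the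
    first antiderivative, \<open>i + j + 1\<close> for the second.\<close>
  have 1: "((\<lambda>t. C * t ^ Suc k / (D * real (Suc k))) has_real_derivative C * t ^ k / D) (at t)" for C D k
  proof -
    have "((\<lambda>t. (C / (D * real (Suc k))) * t ^ Suc k) has_real_derivative
        (C / (D * real (Suc k))) * (real (Suc k) * t ^ k)) (at t)"
      by (rule DERIV_cmult) (use DERIV_pow[of "Suc k" t] in simp)
    moreover have "(C / (D * real (Suc k))) * (real (Suc k) * t ^ k) = C * t ^ k / D"
      by (simp add: field_simps del: of_nat_Suc)
    ultimately show ?thesis by simp
  qed
  have "((\<lambda>t. \<Sum>i<N. \<Sum>j<N. c i * c j * t ^ Suc (i + j) / (1 * real (Suc (i + j)))) has_real_derivative
      (\<Sum>i<N. \<Sum>j<N. c i * c j * t ^ (i + j) / 1)) (at t)"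
    by (intro DERIV_sum 1)
  then show "((\<lambda>t. \<Sum>i<N. \<Sum>j<N. c i * c j * t ^ (i + j + 1) / real (i + j + 1)) has_real_derivative
      (\<Sum>i<N. c i * t ^ i)\<^sup>2) (at t)"
    by (simp add: power2_eq_square sum_product power_add mult_ac)
  have "((\<lambda>t. \<Sum>i<N. \<Sum>j<N. c i * c j * t ^ Suc (i + j + 1) / (real (i + j + 1) * real (Suc (i + j + 1))))
      has_real_derivative (\<Sum>i<N. \<Sum>j<N. c i * c j * t ^ (i + j + 1) / real (i + j + 1))) (at t)"
    by (intro DERIV_sum 1)
  moreover have "Suc (i + j + 1) = i + j + 2" for i j :: nat
    by simp
  ultimately show "((\<lambda>t. \<Sum>i<N. \<Sum>j<N. c i * c j * t ^ (i + j + 2) / real ((i + j + 1) * (i + j + 2)))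
      has_real_derivative (\<Sum>i<N. \<Sum>j<N. c i * c j * t ^ (i + j + 1) / real (i + j + 1))) (at t)"
    by (simp only: of_nat_mult)
qed

text \<open>The triple sum is the remainder, the integral of (1 - t) \<phi>''(t) over [0, 1],
  because t^k integrates against 1 - t to 1 / ((k + 1) (k + 2)). Integrals are avoided by
  subtracting from \<phi> a second antiderivative \<open>B\<close> of \<phi>'' with
  \<open>B 0 = 0\<close> and \<open>A 0 = 0\<close>, where \<open>A\<close> is the derivative of
  \<open>B\<close>.\<close>

lemma taylor_square_sum:
  fixes \<phi> \<phi>' :: "real \<Rightarrow> real" and c :: "'l \<Rightarrow> nat \<Rightarrow> real"
  assumes d1: "\<And>t. (\<phi> has_real_derivative \<phi>' t) (at t)"
    and d2: "\<And>t. (\<phi>' has_real_derivative (\<Sum>l\<in>L. (\<Sum>i<N l. c l i * t ^ i)\<^sup>2)) (at t)"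
  shows "\<phi> 1 = \<phi> 0 + \<phi>' 0 +
    (\<Sum>l\<in>L. \<Sum>i<N l. \<Sum>j<N l. c l i * c l j / real ((i + j + 1) * (i + j + 2)))"
proof -
  define A where "A t = (\<Sum>l\<in>L. \<Sum>i<N l. \<Sum>j<N l. c l i * c l j * t ^ (i + j + 1) / real (i + j + 1))" for t
  define B where "B t = (\<Sum>l\<in>L. \<Sum>i<N l. \<Sum>j<N l. c l i * c l j * t ^ (i + j + 2) / real ((i + j + 1) * (i + j + 2)))" for t
  have A: "(A has_real_derivative (\<Sum>l\<in>L. (\<Sum>i<N l. c l i * t ^ i)\<^sup>2)) (at t)" for t
    unfolding A_def[abs_def] by (intro DERIV_sum DERIV_square_double_sum(1))
  have B: "(B has_real_derivative A t) (at t)" for t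
    unfolding A_def B_def[abs_def] by (intro DERIV_sum DERIV_square_double_sum(2))
  have A0: "A 0 = 0" and B0: "B 0 = 0"
    by (simp_all add: A_def B_def)
  have "((\<lambda>t. \<phi>' t - A t) has_real_derivative 0) (at t)" for t
    using DERIV_diff[OF d2 A] by simp
  then have "\<phi>' t - A t = \<phi>' 0 - A 0" for t
    using DERIV_isconst_all[of "\<lambda>t. \<phi>' t - A t" t 0] by blast
  then have "\<phi>' t - A t = \<phi>' 0" for t
    using A0 by simp
  moreover have "((\<lambda>t. \<phi> t - B t - \<phi>' 0 * t) has_real_derivative \<phi>' t - A t - \<phi>' 0 * 1) (at t)" for t
    by (intro DERIV_diff DERIV_cmult DERIV_ident d1 B)
  ultimately have "((\<lambda>t. \<phi> t - B t - \<phi>' 0 * t) has_real_derivative 0) (at t)" for t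
    by simp
  then have "\<phi> 1 - B 1 - \<phi>' 0 * 1 = \<phi> 0 - B 0 - \<phi>' 0 * 0"
    using DERIV_isconst_all[of "\<lambda>t. \<phi> t - B t - \<phi>' 0 * t" 1 0] by blast
  then show ?thesis
    using B0 by (simp add: B_def)
qed

text \<open>The form is \<open>B 1\<close>, the integral of (1 - t) times the square of the
  polynomial with coefficients \<open>c\<close> over [0, 1]. \<open>A\<close> starts at 0 and has a
  square as derivative, \<open>B\<close> starts at 0 and has derivative \<open>A\<close>; so first
  \<open>A\<close> and then \<open>B\<close> is nonnegative to the right of 0.\<close>

lemma moment_matrix_psd:
  fixes c :: "nat \<Rightarrow> real"
  shows "(\<Sum>i<N. \<Sum>j<N. 1 / real ((i + j + 1) * (i + j + 2)) * c i * c j) \<ge> 0"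
proof -
  define A where "A t = (\<Sum>i<N. \<Sum>j<N. c i * c j * t ^ (i + j + 1) / real (i + j + 1))" for t
  define B where "B t = (\<Sum>i<N. \<Sum>j<N. c i * c j * t ^ (i + j + 2) / real ((i + j + 1) * (i + j + 2)))" for t
  have A: "(A has_real_derivative (\<Sum>i<N. c i * t ^ i)\<^sup>2) (at t)" for t
    unfolding A_def[abs_def] by (rule DERIV_square_double_sum(1))
  have B: "(B has_real_derivative A t) (at t)" for t
    unfolding A_def B_def[abs_def] by (rule DERIV_square_double_sum(2))
  have "A t \<ge> 0" if "t \<ge> 0" for t
  proof -
    have "A 0 \<le> A t"
    proof (rule DERIV_nonneg_imp_nondecreasing[where f = A, OF that])
      fix z
      show "\<exists>y. (A has_real_derivative y) (at z) \<and> 0 \<le> y"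
        by (intro exI[of _ "(\<Sum>i<N. c i * z ^ i)\<^sup>2"] conjI A) simp
    qed
    moreover have "A 0 = 0"
      by (simp add: A_def)
    ultimately show ?thesis
      by simp
  qed
  then have "\<exists>y. (B has_real_derivative y) (at z) \<and> 0 \<le> y" if "0 \<le> z" for z
    using that by (intro exI[of _ "A z"] conjI B) simp_all
  then have "B 0 \<le> B 1"
    by (intro DERIV_nonneg_imp_nondecreasing[where f = B and a = 0 and b = 1]) simp_all
  moreover have "B 0 = 0"
    by (simp add: B_def)
  moreover have "B 1 = (\<Sum>i<N. \<Sum>j<N. 1 / real ((i + j + 1) * (i + j + 2)) * c i * c j)"
    unfolding B_def by (intro sum.cong refl) simp
  ultimately show ?thesis
    by (simp only:)
qed

subsection \<open>Systems of convex polynomial inequalities\<close>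

lemma real_polynomial_function_poly:
  fixes q :: "real \<Rightarrow> real"
  assumes "real_polynomial_function q"
  obtains P where "q = poly P"
proof -
  obtain a n where q: "q = (\<lambda>x. \<Sum>i\<le>n. a i * x ^ i)"
    using real_polynomial_function_imp_sum[OF assms] by blast
  have "q = poly (\<Sum>i\<le>n. monom (a i) i)"
    by (auto simp: q poly_sum poly_monom)
  then show ?thesis ..
qed

lemma real_polynomial_function_line:
  fixes f :: "'a::real_normed_vector \<Rightarrow> real"
  assumes "real_polynomial_function f"
  shows "real_polynomial_function (\<lambda>t. f (x + t *\<^sub>R v))"
proof -
  have "polynomial_function (\<lambda>t. x + t *\<^sub>R v)"
    by (intro polynomial_function_add polynomial_function_const polynomial_function_bounded_linear
        bounded_linear_scaleR_left)
  then show ?thesis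
    using real_polynomial_function_compose[OF _ assms] by (simp add: o_def)
qed

lemma bounded_poly_imp_degree_zero:
  fixes P :: "real poly"
  assumes "\<And>t. t \<ge> 0 \<Longrightarrow> \<bar>poly P t\<bar> \<le> B"
  shows "degree P = 0"
proof (rule ccontr)
  assume "degree P \<noteq> 0"
  then have "filterlim (poly P) at_infinity at_infinity"
    by (intro filterlim_poly_at_infinity) (auto simp: filterlim_ident)
  then have "filterlim (poly P) at_infinity at_top"
    by (rule filterlim_mono) (auto simp: at_top_le_at_infinity)
  then have "eventually (\<lambda>t. norm (poly P t) \<ge> B + 1) at_top"
    unfolding filterlim_at_infinity[OF order_refl]
    \<comment> \<open>For \<open>B + 1 \<le> 0\<close> the bound is trivial, a norm being
      nonnegative.\<close>
    by (cases "B + 1 > 0") (auto simp: eventually_at_top_linorder intro: order_trans[of _ 0])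
  then obtain t where "t \<ge> 0" "norm (poly P t) \<ge> B + 1"
    unfolding eventually_at_top_linorder by (metis max.cobounded1 max.cobounded2)
  with assms[of t] show False
    by simp
qed

text \<open>The derivative is increasing by convexity and nonpositive by monotonicity, hence bounded
  on the half-line; a polynomial bounded there is constant.\<close>

lemma convex_antimono_poly_affine:
  fixes P :: "real poly"
  assumes conv: "convex_on UNIV (poly P)" and anti: "antimono (poly P)"
  obtains c where "\<And>t. poly P t = poly P 0 - t * c" "c \<ge> 0"
proof -
  have tangent: "poly (pderiv P) x * (y - x) \<le> poly P y - poly P x" for x y
    by (rule convex_on_imp_above_tangent[OF conv]) (auto intro: poly_DERIV)
  have "mono (poly (pderiv P))"
  proof (rule monoI)
    fix x y :: real assume "x \<le> y"
    show "poly (pderiv P) x \<le> poly (pderiv P) y"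
    proof (cases "x = y")
      case False
      have 1: "poly P y \<ge> poly P x + poly (pderiv P) x * (y - x)"
        using tangent[of x y] by simp
      have 2: "poly P x \<ge> poly P y + poly (pderiv P) y * (x - y)"
        using tangent[of y x] by simp
      have "(poly (pderiv P) y - poly (pderiv P) x) * (y - x) \<ge> 0"
        using 1 2 by (simp add: algebra_simps)
      then show ?thesis
        using False \<open>x \<le> y\<close> by (simp add: zero_le_mult_iff)
    qed simp
  qed
  moreover have nonpos: "poly (pderiv P) x \<le> 0" for x
  proof -
    have "poly P (x + 1) \<ge> poly P x + poly (pderiv P) x * (x + 1 - x)"
      using tangent[of x "x + 1"] by simp
    moreover have "poly P (x + 1) \<le> poly P x"
      using antimonoD[OF anti, of x "x + 1"] by simp
    ultimately show ?thesis by simp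
  qed
  ultimately have "\<bar>poly (pderiv P) t\<bar> \<le> \<bar>poly (pderiv P) 0\<bar>" if "t \<ge> 0" for t
    using monoD[of _ 0 t] that nonpos[of 0] nonpos[of t] by fastforce
  then have "degree (pderiv P) = 0"
    by (rule bounded_poly_imp_degree_zero)
  then obtain c where c: "pderiv P = [:c:]"
    by (rule degree_eq_zeroE)
  have "((\<lambda>t. poly P t - t * c) has_real_derivative 0) (at t)" for t
    using poly_DERIV[of P t] c by (auto intro!: derivative_eq_intros)
  then have const: "poly P t - t * c = poly P 0 - 0 * c" for t
    using DERIV_isconst_all[of "\<lambda>t. poly P t - t * c" t 0] by blast
  have "poly P t = poly P 0 - t * (- c)" for t
    using const[of t] by simp
  moreover have "- c \<ge> 0"
    using nonpos[of 0] c by simp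
  ultimately show ?thesis ..
qed

text \<open>On each line in direction \<open>v\<close>, \<open>f\<close> is a nonincreasing convex
  polynomial, hence affine. That all these lines share one slope comes from convexity across
  lines.\<close>

lemma convex_polynomial_recession:
  fixes f :: "'a::real_normed_vector \<Rightarrow> real"
  assumes poly: "real_polynomial_function f" and conv: "convex_on UNIV f"
    and rec: "\<And>x t. t \<ge> 0 \<Longrightarrow> f (x + t *\<^sub>R v) \<le> f x"
  obtains s where "s \<ge> 0" "\<And>x t. f (x + t *\<^sub>R v) = f x - t * s"
proof -
  have "\<exists>c\<ge>0. \<forall>t. f (x + t *\<^sub>R v) = f x - t * c" for x
  proof -
    obtain P where P: "(\<lambda>t. f (x + t *\<^sub>R v)) = poly P"
      using real_polynomial_function_poly[OF real_polynomial_function_line[OF poly]] .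
    have "convex_on UNIV (\<lambda>t. f (x + t *\<^sub>R v))"
    proof (rule convex_onI)
      fix t a b :: real assume t: "0 < t" "t < 1"
      have "x + ((1 - t) *\<^sub>R a + t *\<^sub>R b) *\<^sub>R v = (1 - t) *\<^sub>R (x + a *\<^sub>R v) + t *\<^sub>R (x + b *\<^sub>R v)"
        by (simp add: algebra_simps)
      then show "f (x + ((1 - t) *\<^sub>R a + t *\<^sub>R b) *\<^sub>R v)
          \<le> (1 - t) * f (x + a *\<^sub>R v) + t * f (x + b *\<^sub>R v)"
        using convex_onD[OF conv, of t] t by simp
    qed simp
    moreover have "antimono (\<lambda>t. f (x + t *\<^sub>R v))"
    proof (rule antimonoI)
      fix a b :: real assume "a \<le> b"
      then show "f (x + b *\<^sub>R v) \<le> f (x + a *\<^sub>R v)"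
        using rec[of "b - a" "x + a *\<^sub>R v"] by (simp add: algebra_simps)
    qed
    ultimately obtain c where "\<And>t. poly P t = poly P 0 - t * c" "c \<ge> 0"
      using convex_antimono_poly_affine[of P] unfolding P by blast
    then show ?thesis
      using fun_cong[OF P] by (metis add.right_neutral scaleR_zero_left)
  qed
  then obtain s where s: "\<And>x. s x \<ge> 0" "\<And>x t. f (x + t *\<^sub>R v) = f x - t * s x"
    by metis
  \<comment> \<open>A step of weight \<open>l\<close> from \<open>x\<close> towards the distant
    point \<open>y + (1/l) *\<^sub>R v\<close> ends near \<open>x + v\<close> for small
    \<open>l\<close>. In the limit \<open>*\<close> becomes
    \<open>f (x + v) \<le> f x - s y\<close>, and the left side equals
    \<open>f x - s x\<close>.\<close>
  have le: "s y \<le> s x" for x y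
  proof -
    have *: "f ((1 - l) *\<^sub>R x + l *\<^sub>R y + v) \<le> (1 - l) * f x + l * f y - s y"
      if "0 < l" "l < 1" for l
    proof -
      have eq: "(1 - l) *\<^sub>R x + l *\<^sub>R y + v = (1 - l) *\<^sub>R x + l *\<^sub>R (y + (1/l) *\<^sub>R v)"
        using that by (simp add: algebra_simps)
      have "f ((1 - l) *\<^sub>R x + l *\<^sub>R y + v) \<le> (1 - l) * f x + l * f (y + (1/l) *\<^sub>R v)"
        unfolding eq by (rule convex_onD[OF conv]) (use that in auto)
      then show ?thesis
        using that by (simp add: s(2) algebra_simps)
    qed
    have cont: "isCont f z" for z
      using poly continuous_real_polymonial_function by blast
    have "((\<lambda>l. f ((1 - l) *\<^sub>R x + l *\<^sub>R y + v)) \<longlongrightarrow> f ((1 - 0) *\<^sub>R x + 0 *\<^sub>R y + v)) (at_right 0)"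
      by (rule isCont_tendsto_compose[OF cont]) (intro tendsto_intros)
    moreover have "((\<lambda>l. (1 - l) * f x + l * f y - s y) \<longlongrightarrow> (1 - 0) * f x + 0 * f y - s y) (at_right 0)"
      by (intro tendsto_intros)
    moreover have "eventually (\<lambda>l. f ((1 - l) *\<^sub>R x + l *\<^sub>R y + v) \<le> (1 - l) * f x + l * f y - s y)
        (at_right (0::real))"
      unfolding eventually_at_right_field using * by (intro exI[of _ 1]) auto
    ultimately have "f ((1 - 0) *\<^sub>R x + 0 *\<^sub>R y + v) \<le> (1 - 0) * f x + 0 * f y - s y"
      by (intro tendsto_le[of "at_right (0::real)"]) auto
    then show ?thesis
      using s(2)[of x 1] by simp
  qed
  show ?thesis
    using that[of "s 0"] s le by (metis order_antisym)
qed

text \<open>Terms of norm exceeding each \<open>n\<close> are picked first, then a subsequence along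
  which their directions converge on the compact unit sphere. \<open>r\<close> composes both choices
  and need not be increasing.\<close>

lemma unbounded_recession_direction:
  fixes x :: "nat \<Rightarrow> 'a::euclidean_space"
  assumes "\<not> bounded (range x)"
  obtains v r where "norm v = 1" "\<And>n. norm (x (r n)) > real n"
    "(\<lambda>n. x (r n) /\<^sub>R norm (x (r n))) \<longlonglongrightarrow> v"
proof -
  have "\<exists>k. norm (x k) > real n" for n
    using assms by (auto simp: bounded_iff not_le)
  then obtain k where k: "\<And>n. norm (x (k n)) > real n"
    by metis
  define y where "y n = x (k n) /\<^sub>R norm (x (k n))" for n
  have "y n \<in> sphere 0 1" for n
    using order.strict_trans1[OF of_nat_0_le_iff k[of n]] by (simp add: y_def)
  then obtain v r where v: "v \<in> sphere 0 1" and r: "strict_mono r" "(y \<circ> r) \<longlonglongrightarrow> v"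
    using compact_sphere[of 0 1] unfolding compact_def by metis
  have "norm (x (k (r n))) > real n" for n
    using k[of "r n"] seq_suble[OF r(1), of n] by (simp add: order.strict_trans1)
  moreover have "(\<lambda>n. x (k (r n)) /\<^sub>R norm (x (k (r n)))) \<longlonglongrightarrow> v"
    using r(2) by (simp add: y_def o_def)
  ultimately show ?thesis
    using that[of v "k \<circ> r"] v by simp
qed

text \<open>\<open>x + t *\<^sub>R v\<close> is the limit of points on the segments from
  \<open>x\<close> to \<open>y n\<close>, at the parameter \<open>l n = t / norm (y n)\<close>
  tending to 0; convexity bounds \<open>f\<close> there by
  \<open>(1 - l n) * f x + l n * B\<close>.\<close>

lemma convex_recession_le:
  fixes f :: "'a::euclidean_space \<Rightarrow> real"
  assumes conv: "convex_on UNIV f"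
    and y: "\<And>n. norm (y n) > real n" and v: "(\<lambda>n. y n /\<^sub>R norm (y n)) \<longlonglongrightarrow> v"
    and bdd: "\<And>n. f (y n) \<le> B" and t: "t \<ge> 0"
  shows "f (x + t *\<^sub>R v) \<le> f x"
proof -
  define l where "l n = t / norm (y n)" for n
  have pos: "norm (y n) > 0" for n
    using y[of n] of_nat_0_le_iff[of n] by linarith
  have "filterlim (\<lambda>n. norm (y n)) at_top sequentially"
    using filterlim_real_sequentially by (rule filterlim_at_top_mono) (intro always_eventually allI less_imp_le y)
  then have l0: "l \<longlonglongrightarrow> 0"
    unfolding l_def[abs_def] by (intro tendsto_divide_0[OF tendsto_const] filterlim_at_top_imp_at_infinity)
  have "(\<lambda>n. (1 - l n) *\<^sub>R x + t *\<^sub>R (y n /\<^sub>R norm (y n))) \<longlonglongrightarrow> (1 - 0) *\<^sub>R x + t *\<^sub>R v"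
    by (intro tendsto_intros l0 v)
  moreover have "continuous_on UNIV f"
    using convex_on_continuous[OF open_UNIV conv] .
  then have "isCont f z" for z
    by (simp add: continuous_on_eq_continuous_at)
  ultimately have "(\<lambda>n. f ((1 - l n) *\<^sub>R x + t *\<^sub>R (y n /\<^sub>R norm (y n)))) \<longlonglongrightarrow> f ((1 - 0) *\<^sub>R x + t *\<^sub>R v)"
    by (rule isCont_tendsto_compose[rotated])
  moreover have "(\<lambda>n. (1 - l n) * f x + l n * B) \<longlonglongrightarrow> (1 - 0) * f x + 0 * B"
    by (intro tendsto_intros l0)
  moreover have "eventually (\<lambda>n. f ((1 - l n) *\<^sub>R x + t *\<^sub>R (y n /\<^sub>R norm (y n)))
      \<le> (1 - l n) * f x + l n * B) sequentially"
  proof -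
    have "eventually (\<lambda>n. l n < 1) sequentially"
      using order_tendstoD(2)[OF l0, of 1] by simp
    then show ?thesis
    proof eventually_elim
      case (elim n)
      have l: "l n \<ge> 0"
        using t by (simp add: l_def)
      have eq: "t *\<^sub>R (y n /\<^sub>R norm (y n)) = l n *\<^sub>R y n"
        by (simp add: l_def divide_inverse)
      have "f ((1 - l n) *\<^sub>R x + t *\<^sub>R (y n /\<^sub>R norm (y n))) \<le> (1 - l n) * f x + l n * f (y n)"
        unfolding eq by (rule convex_onD[OF conv]) (use l elim in auto)
      also have "\<dots> \<le> (1 - l n) * f x + l n * B"
        using bdd[of n] l by (simp add: mult_left_mono)
      finally show ?case .
    qed
  qed
  ultimately have "f ((1 - 0) *\<^sub>R x + t *\<^sub>R v) \<le> (1 - 0) * f x + 0 * B"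
    by (intro tendsto_le[OF sequentially_bot]) auto
  then show ?thesis
    by simp
qed

text \<open>Induction over proper subsets of \<open>I\<close>: in the unbounded case the limit
  system is first solved for the constraints \<open>J\<close> that are constant along
  \<open>v\<close>, and the others are then met by moving far along \<open>v\<close>.\<close>

lemma convex_polynomial_system_closed:
  fixes F :: "'i \<Rightarrow> 'a::euclidean_space \<Rightarrow> real"
  assumes "finite I"
    and poly: "\<And>i. i \<in> I \<Longrightarrow> real_polynomial_function (F i)"
    and conv: "\<And>i. i \<in> I \<Longrightarrow> convex_on UNIV (F i)"
    and lim: "\<And>i. i \<in> I \<Longrightarrow> (\<lambda>k. c k i) \<longlonglongrightarrow> c' i"
    and sol: "\<And>k. \<exists>x. \<forall>i\<in>I. F i x \<le> c k i"
  shows "\<exists>x. \<forall>i\<in>I. F i x \<le> c' i"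
  using assms
proof (induction I rule: finite_psubset_induct)
  case (psubset I)
  note poly = psubset.prems(1) and conv = psubset.prems(2) and lim = psubset.prems(3)
    and sol = psubset.prems(4)
  have cont: "continuous_on UNIV (F i)" if "i \<in> I" for i
    using convex_on_continuous[OF open_UNIV conv[OF that]] .
  \<comment> \<open>A solution of least norm is chosen in each system; minimality later excludes
    that all constraints are constant along \<open>v\<close>.\<close>
  have "\<exists>x. (\<forall>i\<in>I. F i x \<le> c k i) \<and> (\<forall>y. (\<forall>i\<in>I. F i y \<le> c k i) \<longrightarrow> norm x \<le> norm y)" for k
  proof -
    have "closed (\<Inter>i\<in>I. {x. F i x \<le> c k i})"
      using cont by (intro closed_INT ballI closed_Collect_le continuous_on_const)
    moreover have "(\<Inter>i\<in>I. {x. F i x \<le> c k i}) \<noteq> {}"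
      using sol[of k] by auto
    ultimately obtain x where "x \<in> (\<Inter>i\<in>I. {x. F i x \<le> c k i})"
      "\<And>y. y \<in> (\<Inter>i\<in>I. {x. F i x \<le> c k i}) \<Longrightarrow> dist 0 x \<le> dist 0 y"
      using distance_attains_inf[of "\<Inter>i\<in>I. {x. F i x \<le> c k i}" 0] by blast
    then show ?thesis
      by (intro exI[of _ x]) simp
  qed
  then obtain x where "\<And>k. (\<forall>i\<in>I. F i (x k) \<le> c k i) \<and>
      (\<forall>y. (\<forall>i\<in>I. F i y \<le> c k i) \<longrightarrow> norm (x k) \<le> norm y)"
    by metis
  then have x: "\<And>k i. i \<in> I \<Longrightarrow> F i (x k) \<le> c k i"
    and least: "\<And>k y. (\<And>i. i \<in> I \<Longrightarrow> F i y \<le> c k i) \<Longrightarrow> norm (x k) \<le> norm y"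
    by blast+
  show ?case
  proof (cases "bounded (range x)")
    case True
    then obtain l r where r: "strict_mono r" "(x \<circ> r) \<longlonglongrightarrow> l"
      using bounded_imp_convergent_subsequence by blast
    have "F i l \<le> c' i" if i: "i \<in> I" for i
    proof (rule LIMSEQ_le)
      have "isCont (F i) l"
        using cont[OF i] by (simp add: continuous_on_eq_continuous_at)
      then show "(\<lambda>n. F i ((x \<circ> r) n)) \<longlonglongrightarrow> F i l"
        using r(2) by (rule isCont_tendsto_compose)
      show "(\<lambda>n. c (r n) i) \<longlonglongrightarrow> c' i"
        using LIMSEQ_subseq_LIMSEQ[OF lim[OF i] r(1)] by (simp add: o_def)
    qed (use x i in auto)
    then show ?thesis
      by auto
  next
    case False
    then obtain v r where v: "norm v = 1" and r: "\<And>n. norm (x (r n)) > real n"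
      and rv: "(\<lambda>n. x (r n) /\<^sub>R norm (x (r n))) \<longlonglongrightarrow> v"
      using unbounded_recession_direction by blast
    have "\<exists>s\<ge>0. \<forall>y t. F i (y + t *\<^sub>R v) = F i y - t * s" if i: "i \<in> I" for i
    proof -
      \<comment> \<open>The right-hand sides converge, so they are bounded and bound
        \<open>F i\<close> from above along the sequence; hence \<open>F i\<close> does not increase
        in direction \<open>v\<close>.\<close>
      have "Bseq (\<lambda>k. c k i)"
        using convergentI[OF lim[OF i]] by (rule convergent_imp_Bseq)
      then obtain B where B: "\<And>k. norm (c k i) \<le> B"
        using BseqE by metis
      have "F i (x (r n)) \<le> B" for n
        using x[OF i, of "r n"] B[of "r n"] by simp
      then have "F i (y + t *\<^sub>R v) \<le> F i y" if "0 \<le> t" for y t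
        using convex_recession_le[OF conv[OF i] r rv _ that] by blast
      from convex_polynomial_recession[OF poly[OF i] conv[OF i] this]
      obtain s where "s \<ge> 0" "\<And>y t. F i (y + t *\<^sub>R v) = F i y - t * s"
        by blast
      then show ?thesis
        by blast
    qed
    then obtain s where s: "\<And>i. i \<in> I \<Longrightarrow> s i \<ge> 0"
      "\<And>i y t. i \<in> I \<Longrightarrow> F i (y + t *\<^sub>R v) = F i y - t * s i"
      by metis
    define J where "J = {i \<in> I. s i = 0}"
    have "J \<noteq> I"
    proof
      assume "J = I"
      \<comment> \<open>With all slopes 0, removing from \<open>x k\<close> its component along
        \<open>v\<close> gives another solution, so least norm leaves no such component. The limit
        \<open>v\<close> of the normalised solutions would then be orthogonal to itself.\<close>
      have orth: "x k \<bullet> v = 0" for k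
      proof -
        define y where "y = x k + (- (x k \<bullet> v)) *\<^sub>R v"
        have "F i y \<le> c k i" if "i \<in> I" for i
        proof -
          have "s i = 0"
            using that \<open>J = I\<close> by (auto simp: J_def)
          then show ?thesis
            unfolding y_def using s(2)[OF that, of "x k" "- (x k \<bullet> v)"] x[OF that, of k] by simp
        qed
        then have "norm (x k) \<le> norm y"
          by (rule least)
        then have "x k \<bullet> x k \<le> y \<bullet> y"
          by (simp add: norm_le)
        also have "\<dots> = x k \<bullet> x k - (x k \<bullet> v)\<^sup>2"
          using v by (simp add: y_def inner_simps power2_eq_square inner_commute
              norm_eq_1)
        finally show ?thesis
          by simp
      qed
      have "(\<lambda>n. (x (r n) /\<^sub>R norm (x (r n))) \<bullet> v) \<longlonglongrightarrow> v \<bullet> v"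
        by (intro tendsto_intros rv)
      then have "v \<bullet> v = 0"
        by (simp add: orth LIMSEQ_const_iff)
      with v show False
        by simp
    qed
    then have "J \<subset> I"
      by (auto simp: J_def)
    then have "\<exists>z. \<forall>i\<in>J. F i z \<le> c' i"
      by (rule psubset.IH) (use poly conv lim sol \<open>J \<subset> I\<close> in \<open>blast+\<close>)
    then obtain z where z: "\<And>i. i \<in> J \<Longrightarrow> F i z \<le> c' i"
      by blast
    \<comment> \<open>\<open>t\<close> dominates each quotient in the sum, so the decrease
      \<open>t * s i\<close> covers the violation of every constraint outside \<open>J\<close>;
      those in \<open>J\<close> do not change.\<close>
    define t where "t = (\<Sum>i\<in>I - J. \<bar>F i z - c' i\<bar> / s i)"
    have "F i (z + t *\<^sub>R v) \<le> c' i" if i: "i \<in> I" for i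
    proof (cases "i \<in> J")
      case True
      then show ?thesis
        using z s(2)[OF i, of z t] by (simp add: J_def)
    next
      case False
      then have si: "s i > 0"
        using s(1)[OF i] i by (simp add: J_def less_le)
      have "\<bar>F i z - c' i\<bar> / s i \<le> t"
        unfolding t_def using False i psubset.hyps s(1)
        by (intro member_le_sum) auto
      then have "\<bar>F i z - c' i\<bar> \<le> t * s i"
        using si by (simp add: field_simps)
      then show ?thesis
        using s(2)[OF i, of z t] by simp
    qed
    then show ?thesis
      by blast
  qed
qed

text \<open>Closedness for a single inequality: the right-hand sides, infimum plus
  \<open>1 / Suc k\<close>, are all solvable and tend to the infimum.\<close>

lemma convex_polynomial_attains_inf:
  fixes f :: "'a::euclidean_space \<Rightarrow> real"
  assumes "real_polynomial_function f" "convex_on UNIV f" "\<And>x. f x \<ge> B"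
  shows "\<exists>a. \<forall>x. f a \<le> f x"
proof -
  have bdd: "bdd_below (range f)"
    using assms(3) by (auto intro!: bdd_belowI)
  have "\<exists>x. \<forall>i\<in>{()}. f x \<le> (INF x. f x)"
  proof (rule convex_polynomial_system_closed[where c = "\<lambda>k i. (INF x. f x) + 1 / Suc k"])
    show "\<exists>x. \<forall>i\<in>{()}. f x \<le> (INF x. f x) + 1 / real (Suc k)" for k
    proof -
      have "(INF x. f x) < (INF x. f x) + 1 / real (Suc k)"
        by simp
      then show ?thesis
        unfolding cINF_less_iff[OF UNIV_not_empty bdd] by (auto intro: less_imp_le)
    qed
    show "(\<lambda>k. (INF x. f x) + 1 / real (Suc k)) \<longlonglongrightarrow> (INF x. f x)"
      using tendsto_add[OF tendsto_const LIMSEQ_Suc[OF lim_1_over_n]] by simp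
  qed (use assms in auto)
  then obtain a where "f a \<le> (INF x. f x)"
    by auto
  moreover have "(INF x. f x) \<le> f x" for x
    using cINF_lower[OF bdd] by simp
  ultimately show ?thesis
    by (intro exI[of _ a] allI) (rule order_trans)
qed

subsection \<open>SOS-convex polynomials\<close>

definition gradient_rpoly :: "('n::finite) rpoly \<Rightarrow> real ^ 'n \<Rightarrow> real ^ 'n" where
  "gradient_rpoly f x = (\<chi> i. eval_rpoly (partial_rpoly i f) x)"

lemma eval_rpoly_directional_derivative:
  "((\<lambda>t. eval_rpoly f (a + t *\<^sub>R w)) has_real_derivative
    gradient_rpoly f (a + t *\<^sub>R w) \<bullet> w) (at t)"
  using eval_rpoly_line_derivative[of f a w t]
  by (simp add: gradient_rpoly_def inner_vec_def mult.commute)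

text \<open>Substituting a_i + (x_i - a_i) t for each variable gives a polynomial in
  \<open>t\<close> with coefficients in R[x], which is the type of \<open>U\<close>; a real
  \<open>t\<close> enters as a constant polynomial. Applied to the entries of \<open>H\<close>, this
  supplies the polynomials at which the quadratic form of the Taylor remainder is taken.\<close>

lemma rpoly_along_line:
  fixes f :: "('n::finite) rpoly"
  shows "\<exists>U :: 'n rpoly poly. \<forall>x t. eval_rpoly f (a + t *\<^sub>R (x - a)) = eval_rpoly (poly U (const_rpoly t)) x"
proof -
  define U :: "'n rpoly poly" where
    "U = (\<Sum>b\<in>Poly_Mapping.keys f. [:const_rpoly (Poly_Mapping.lookup f b):] *
       (\<Prod>i\<in>UNIV. [:const_rpoly (a $ i), var_rpoly i - const_rpoly (a $ i):] ^ Poly_Mapping.lookup b i))"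
  have "eval_rpoly f (a + t *\<^sub>R (x - a)) = eval_rpoly (poly U (const_rpoly t)) x" for x t
    by (simp add: U_def eval_rpoly_def[of f] poly_sum poly_prod)
  then show ?thesis
    by (intro exI[of _ U] allI)
qed

text \<open>With w = x - a, the second derivative along the line is w^T H H^T w, a sum over the
  columns of squares of polynomials in \<open>t\<close>. Integration against 1 - t gives a positive
  semidefinite form in their coefficients. As these are polynomials in \<open>x\<close>, the
  remainder is a sum of squares of polynomials and not just nonnegative.\<close>

lemma sos_convex_taylor:
  fixes f :: "('n::finite) rpoly" and a :: "real ^ 'n"
  assumes "sos_convex f"
  shows "\<exists>\<sigma>. sos \<sigma> \<and>
    (\<forall>x. eval_rpoly f x = eval_rpoly f a + gradient_rpoly f a \<bullet> (x - a) + eval_rpoly \<sigma> x)"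
proof -
  obtain s :: nat and H :: "nat \<Rightarrow> 'n rpoly ^ 'n"
    where "hessian_rpoly f = (\<chi> i j. \<Sum>l<s. H l $ i * H l $ j)"
    using assms unfolding sos_convex_def sos_matrix_def by (elim exE)
  then have hess: "partial_rpoly i (partial_rpoly j f) = (\<Sum>l<s. H l $ i * H l $ j)" for i j
    by (simp add: hessian_rpoly_def vec_eq_iff)
  have "\<forall>l. \<exists>V :: 'n rpoly poly. \<forall>x t. (\<Sum>i\<in>UNIV. (x - a) $ i * eval_rpoly (H l $ i) (a + t *\<^sub>R (x - a)))
      = eval_rpoly (poly V (const_rpoly t)) x"
  proof
    fix l
    have "\<forall>i. \<exists>U :: 'n rpoly poly. \<forall>x t. eval_rpoly (H l $ i) (a + t *\<^sub>R (x - a))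
        = eval_rpoly (poly U (const_rpoly t)) x"
      by (intro allI rpoly_along_line)
    from choice[OF this] obtain U :: "'n \<Rightarrow> 'n rpoly poly" where
      U: "\<And>i x t. eval_rpoly (H l $ i) (a + t *\<^sub>R (x - a)) = eval_rpoly (poly (U i) (const_rpoly t)) x"
      by blast
    show "\<exists>V :: 'n rpoly poly. \<forall>x t. (\<Sum>i\<in>UNIV. (x - a) $ i * eval_rpoly (H l $ i) (a + t *\<^sub>R (x - a)))
      = eval_rpoly (poly V (const_rpoly t)) x"
      by (rule exI[of _ "\<Sum>i\<in>UNIV. [:var_rpoly i - const_rpoly (a $ i):] * U i"])
         (simp add: U poly_sum)
  qed
  from choice[OF this] obtain V :: "nat \<Rightarrow> 'n rpoly poly" where
    V: "\<And>l x t. (\<Sum>i\<in>UNIV. (x - a) $ i * eval_rpoly (H l $ i) (a + t *\<^sub>R (x - a)))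
      = eval_rpoly (poly (V l) (const_rpoly t)) x"
    by blast
  \<comment> \<open>\<open>Suc\<close> lets the sums over \<open>i < N l\<close> reach the leading
    coefficient.\<close>
  define N where "N l = Suc (degree (V l))" for l
  define \<sigma> where "\<sigma> = (\<Sum>l<s. \<Sum>i<N l. \<Sum>j<N l.
    const_rpoly (1 / real ((i + j + 1) * (i + j + 2))) * coeff (V l) i * coeff (V l) j)"
  have "sos \<sigma>"
    unfolding \<sigma>_def
    by (intro sos_sum sos_psd_quadratic_form moment_matrix_psd) (simp only: add.commute)
  moreover have "eval_rpoly f x = eval_rpoly f a + gradient_rpoly f a \<bullet> (x - a) + eval_rpoly \<sigma> x" for x
  proof -
    define w where "w = x - a"
    \<comment> \<open>At a fixed \<open>x\<close> the coefficients become real numbers, to which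
      \<open>taylor_square_sum\<close> applies.\<close>
    define c where "c l k = eval_rpoly (coeff (V l) k) x" for l k
    have c: "(\<Sum>k<N l. c l k * t ^ k) =
        (\<Sum>i\<in>UNIV. w $ i * eval_rpoly (H l $ i) (a + t *\<^sub>R w))" for l t
      unfolding w_def V by (simp add: c_def N_def poly_altdef lessThan_Suc_atMost)
    have "(\<Sum>i\<in>UNIV. w $ i * (\<Sum>j\<in>UNIV. w $ j *
        eval_rpoly (partial_rpoly j (partial_rpoly i f)) (a + t *\<^sub>R w)))
        = (\<Sum>l<s. (\<Sum>k<N l. c l k * t ^ k)\<^sup>2)" for t
    proof -
      let ?h = "\<lambda>l i. eval_rpoly (H l $ i) (a + t *\<^sub>R w)"
      have "(\<Sum>i\<in>UNIV. w $ i * (\<Sum>j\<in>UNIV. w $ j * (\<Sum>l<s. ?h l j * ?h l i)))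
          = (\<Sum>i\<in>UNIV. \<Sum>j\<in>UNIV. \<Sum>l<s. (w $ i * ?h l i) * (w $ j * ?h l j))"
        by (simp add: sum_distrib_left mult_ac)
      also have "\<dots> = (\<Sum>i\<in>UNIV. \<Sum>l<s. \<Sum>j\<in>UNIV. (w $ i * ?h l i) * (w $ j * ?h l j))"
        by (intro sum.cong refl) (rule sum.swap)
      also have "\<dots> = (\<Sum>l<s. \<Sum>i\<in>UNIV. \<Sum>j\<in>UNIV. (w $ i * ?h l i) * (w $ j * ?h l j))"
        by (rule sum.swap)
      finally show ?thesis
        unfolding c by (simp add: hess power2_eq_square sum_product)
    qed
    moreover have "((\<lambda>t. \<Sum>i\<in>UNIV. w $ i * eval_rpoly (partial_rpoly i f) (a + t *\<^sub>R w))
        has_real_derivative (\<Sum>i\<in>UNIV. w $ i * (\<Sum>j\<in>UNIV. w $ j *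
        eval_rpoly (partial_rpoly j (partial_rpoly i f)) (a + t *\<^sub>R w)))) (at t)" for t
      by (intro DERIV_sum DERIV_cmult eval_rpoly_line_derivative)
    ultimately have "((\<lambda>t. \<Sum>i\<in>UNIV. w $ i * eval_rpoly (partial_rpoly i f) (a + t *\<^sub>R w))
        has_real_derivative (\<Sum>l<s. (\<Sum>k<N l. c l k * t ^ k)\<^sup>2)) (at t)" for t
      by simp
    note taylor = taylor_square_sum[OF eval_rpoly_line_derivative this]
    show ?thesis
    proof -
      have "(\<Sum>l<s. \<Sum>i<N l. \<Sum>j<N l. c l i * c l j / real ((i + j + 1) * (i + j + 2)))
          = eval_rpoly \<sigma> x"
        unfolding \<sigma>_def c_def eval_rpoly_sum eval_rpoly_mult eval_rpoly_const
        by (intro sum.cong refl) simp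
      moreover have "(\<Sum>i\<in>UNIV. w $ i * eval_rpoly (partial_rpoly i f) a) = gradient_rpoly f a \<bullet> (x - a)"
        by (simp add: w_def gradient_rpoly_def inner_vec_def mult.commute)
      moreover have "a + w = x"
        by (simp add: w_def)
      ultimately show ?thesis
        using taylor by simp
    qed
  qed
  ultimately show ?thesis
    by (intro exI[of _ \<sigma>] conjI allI)
qed

text \<open>The remainder at \<open>z\<close> is a sum of squares, so the graph lies above the
  tangent plane at \<open>z\<close>. Averaging the bounds at \<open>x\<close> and \<open>y\<close>
  cancels the linear terms, since \<open>z\<close> is the corresponding average of \<open>x\<close>
  and \<open>y\<close>.\<close>

lemma sos_convex_imp_convex_on:
  fixes f :: "('n::finite) rpoly"
  assumes "sos_convex f"
  shows "convex_on UNIV (eval_rpoly f)"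
proof (rule convex_onI)
  fix t :: real and x y :: "real ^ 'n"
  assume t: "0 < t" "t < 1"
  define z where "z = (1 - t) *\<^sub>R x + t *\<^sub>R y"
  let ?D = "gradient_rpoly f z"
  obtain \<sigma> where \<sigma>: "sos \<sigma>"
    "\<forall>u. eval_rpoly f u = eval_rpoly f z + ?D \<bullet> (u - z) + eval_rpoly \<sigma> u"
    using sos_convex_taylor[OF assms, of z] by (elim exE conjE)
  have above: "eval_rpoly f z + ?D \<bullet> (u - z) \<le> eval_rpoly f u" for u
    using sos_nonneg[OF \<sigma>(1), of u] \<sigma>(2)[rule_format, of u] by linarith
  have "(1 - t) *\<^sub>R (x - z) + t *\<^sub>R (y - z) = 0"
    by (simp add: z_def algebra_simps)
  then have "?D \<bullet> ((1 - t) *\<^sub>R (x - z) + t *\<^sub>R (y - z)) = 0"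
    by simp
  then have "(1 - t) * (?D \<bullet> (x - z)) + t * (?D \<bullet> (y - z)) = 0"
    by (simp only: inner_add_right inner_scaleR_right)
  moreover have "(1 - t) * (eval_rpoly f z + ?D \<bullet> (x - z)) + t * (eval_rpoly f z + ?D \<bullet> (y - z))
      \<le> (1 - t) * eval_rpoly f x + t * eval_rpoly f y"
    using t by (intro add_mono mult_left_mono above) auto
  moreover have "(1 - t) * (eval_rpoly f z + ?D \<bullet> (x - z)) + t * (eval_rpoly f z + ?D \<bullet> (y - z))
      = eval_rpoly f z + ((1 - t) * (?D \<bullet> (x - z)) + t * (?D \<bullet> (y - z)))"
    by (simp add: algebra_simps)
  ultimately show "eval_rpoly f ((1 - t) *\<^sub>R x + t *\<^sub>R y) \<le> (1 - t) * eval_rpoly f x + t * eval_rpoly f y"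
    by (simp add: z_def)
qed simp

lemma convex_on_sum_cmul:
  assumes "\<And>i. i \<in> I \<Longrightarrow> convex_on UNIV (f i)" "\<And>i. i \<in> I \<Longrightarrow> (0::real) \<le> w i"
  shows "convex_on UNIV (\<lambda>x. \<Sum>i\<in>I. w i * f i x)"
  using assms
  by (induction I rule: infinite_finite_induct)
     (simp_all add: convex_on_const convex_on_add convex_on_cmul)

text \<open>At a minimiser \<open>a\<close> of \<open>L\<close> the weighted gradients cancel.
  Adding up the Taylor expansions of the \<open>q i\<close> at \<open>a\<close> leaves their
  weighted remainders and the constant \<open>eval_rpoly L a + e\<close>, which is nonnegative by
  \<open>nonneg\<close>.\<close>

lemma nonneg_combination_sos:
  fixes q :: "'i \<Rightarrow> ('n::finite) rpoly"
  assumes q: "\<And>i. i \<in> I \<Longrightarrow> sos_convex (q i)" and w: "\<And>i. i \<in> I \<Longrightarrow> 0 \<le> w i"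
    and nonneg: "\<And>x. 0 \<le> (\<Sum>i\<in>I. w i * eval_rpoly (q i) x) + e"
  shows "sos ((\<Sum>i\<in>I. const_rpoly (w i) * q i) + const_rpoly e)"
proof -
  define L where "L = (\<Sum>i\<in>I. const_rpoly (w i) * q i)"
  have L: "eval_rpoly L x = (\<Sum>i\<in>I. w i * eval_rpoly (q i) x)" for x
    by (simp add: L_def)
  have "convex_on UNIV (eval_rpoly L)"
    unfolding L[abs_def] using q w by (intro convex_on_sum_cmul sos_convex_imp_convex_on)
  moreover have "eval_rpoly L x \<ge> - e" for x
    using nonneg[of x] by (simp add: L)
  ultimately have "\<exists>a. \<forall>x. eval_rpoly L a \<le> eval_rpoly L x"
    by (rule convex_polynomial_attains_inf[OF real_polynomial_function_eval_rpoly])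
  then obtain a where a: "\<And>x. eval_rpoly L a \<le> eval_rpoly L x"
    by blast
  have "\<forall>i\<in>I. \<exists>\<sigma>. sos \<sigma> \<and> (\<forall>x. eval_rpoly (q i) x =
      eval_rpoly (q i) a + gradient_rpoly (q i) a \<bullet> (x - a) + eval_rpoly \<sigma> x)"
    by (intro ballI sos_convex_taylor q)
  from bchoice[OF this] obtain \<sigma> where \<sigma>: "\<And>i. i \<in> I \<Longrightarrow> sos (\<sigma> i)"
    "\<And>i x. i \<in> I \<Longrightarrow> eval_rpoly (q i) x =
      eval_rpoly (q i) a + gradient_rpoly (q i) a \<bullet> (x - a) + eval_rpoly (\<sigma> i) x"
    by blast
  have crit: "(\<Sum>i\<in>I. w i * (gradient_rpoly (q i) a \<bullet> v)) = 0" for v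
  proof -
    have "((\<lambda>t. eval_rpoly L (a + t *\<^sub>R v)) has_real_derivative
        (\<Sum>i\<in>I. w i * (gradient_rpoly (q i) (a + 0 *\<^sub>R v) \<bullet> v))) (at 0)"
      unfolding L by (intro DERIV_sum DERIV_cmult eval_rpoly_directional_derivative)
    then have "((\<lambda>t. eval_rpoly L (a + t *\<^sub>R v)) has_real_derivative
        (\<Sum>i\<in>I. w i * (gradient_rpoly (q i) a \<bullet> v))) (at 0)"
      by simp
    then show ?thesis
      by (rule DERIV_local_min[where d = 1]) (use a in auto)
  qed
  have eq: "L + const_rpoly e = (\<Sum>i\<in>I. const_rpoly (w i) * \<sigma> i) + const_rpoly (eval_rpoly L a + e)"
  proof (rule eval_rpoly_inject)
    fix x
    have "eval_rpoly L x = (\<Sum>i\<in>I. w i * eval_rpoly (q i) a +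
        w i * (gradient_rpoly (q i) a \<bullet> (x - a)) + w i * eval_rpoly (\<sigma> i) x)"
      unfolding L
    proof (rule sum.cong[OF refl])
      fix i assume "i \<in> I"
      show "w i * eval_rpoly (q i) x = w i * eval_rpoly (q i) a +
          w i * (gradient_rpoly (q i) a \<bullet> (x - a)) + w i * eval_rpoly (\<sigma> i) x"
        unfolding \<sigma>(2)[OF \<open>i \<in> I\<close>, of x] by (simp only: distrib_left)
    qed
    also have "\<dots> = eval_rpoly L a + (\<Sum>i\<in>I. w i * eval_rpoly (\<sigma> i) x)"
      by (simp add: sum.distrib crit L)
    finally show "eval_rpoly (L + const_rpoly e) x =
        eval_rpoly ((\<Sum>i\<in>I. const_rpoly (w i) * \<sigma> i) + const_rpoly (eval_rpoly L a + e)) x"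
      by simp
  qed
  have "0 \<le> eval_rpoly L a + e"
    unfolding L by (rule nonneg)
  then have "sos (const_rpoly (eval_rpoly L a + e))"
    by (rule sos_const)
  moreover have "sos (\<Sum>i\<in>I. const_rpoly (w i) * \<sigma> i)"
    by (rule sos_sum, rule sos_const_mult, erule w, erule \<sigma>(1))
  ultimately have "sos (L + const_rpoly e)"
    unfolding eq by (rule sos_add[rotated])
  then show ?thesis
    unfolding L_def .
qed

section \<open>Degree bounds\<close>

lemma deg_rpoly_le_iff:
  "deg_rpoly f \<le> d \<longleftrightarrow>
    (\<forall>a\<in>Poly_Mapping.keys f. (\<Sum>i\<in>UNIV. Poly_Mapping.lookup a i) \<le> d)"
  unfolding deg_rpoly_def by (subst Max_le_iff) auto

lemma deg_rpoly_add_le: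
  assumes "deg_rpoly f \<le> d" "deg_rpoly g \<le> d"
  shows "deg_rpoly (f + g) \<le> d"
  using assms Poly_Mapping.keys_add[of f g] unfolding deg_rpoly_le_iff by (meson Un_iff subsetD)

lemma deg_rpoly_const_mult_le:
  assumes "deg_rpoly f \<le> d"
  shows "deg_rpoly (const_rpoly c * f) \<le> d"
proof -
  have "Poly_Mapping.keys (const_rpoly c * f) \<subseteq> Poly_Mapping.keys f"
    using keys_mult[of "const_rpoly c" f] by (auto simp: const_rpoly_def split: if_splits)
  then show ?thesis
    using assms unfolding deg_rpoly_le_iff by (meson subsetD)
qed

lemma deg_rpoly_const [simp]: "deg_rpoly (const_rpoly c) = 0"
  using deg_rpoly_le_iff[of "const_rpoly c" 0] by (auto simp: const_rpoly_def split: if_splits)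

lemma deg_rpoly_sum_le:
  "(\<And>a. a \<in> A \<Longrightarrow> deg_rpoly (f a) \<le> d) \<Longrightarrow> deg_rpoly (\<Sum>a\<in>A. f a) \<le> d"
proof (induction A rule: infinite_finite_induct)
  case (insert a A)
  then show ?case
    by (simp add: deg_rpoly_add_le)
qed (simp_all add: deg_rpoly_def)

section \<open>Multipliers by separation\<close>

lemma nonneg_of_affine_lower_bound:
  fixes a b c :: real
  assumes "\<And>s. s \<ge> 0 \<Longrightarrow> b < c + s * a"
  shows "a \<ge> 0"
proof (rule ccontr)
  assume "\<not> a \<ge> 0"
  then have a: "a < 0"
    by simp
  have "b < c"
    using assms[of 0] by simp
  \<comment> \<open>For this value of \<open>s\<close> the assumed bound would read
    \<open>b < b\<close>.\<close>
  then have "(c - b) / - a \<ge> 0"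
    using a by (intro divide_nonneg_nonneg) auto
  from assms[OF this] a show False
    by simp
qed

text \<open>
  No Slater condition is needed: the convex set that is separated from \<open>(-\<epsilon>, \<dots>, -\<epsilon>, 0)\<close> is closed.
\<close>

lemma convex_polynomial_alternative:
  fixes P :: "'r::finite \<Rightarrow> 'a::euclidean_space \<Rightarrow> real" and G :: "'m::finite \<Rightarrow> 'a \<Rightarrow> real"
  assumes P: "\<And>j. real_polynomial_function (P j)" "\<And>j. convex_on UNIV (P j)"
    and G: "\<And>i. real_polynomial_function (G i)" "\<And>i. convex_on UNIV (G i)"
    and feasible: "\<And>i. G i x0 \<le> 0"
    and nonneg: "\<And>x. (\<And>i. G i x \<le> 0) \<Longrightarrow> \<exists>j. 0 \<le> P j x"
    and e: "e > 0"
  shows "\<exists>\<delta>\<in>(unit_simplex :: (real ^ 'r) set). \<exists>lam\<in>(nonneg_orthant :: (real ^ 'm) set).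
    \<forall>x. 0 < (\<Sum>j\<in>UNIV. \<delta> $ j * P j x) + (\<Sum>i\<in>UNIV. lam $ i * G i x) + e"
proof -
  \<comment> \<open>The right-hand sides for which the system is solvable. This set is upward
    closed, which will fix the signs of the multipliers.\<close>
  define S :: "((real ^ 'r) \<times> (real ^ 'm)) set" where
    "S = {(a, b). \<exists>x. (\<forall>j. P j x \<le> a $ j) \<and> (\<forall>i. G i x \<le> b $ i)}"
  have SI: "(a, b) \<in> S" if "\<And>j. P j x \<le> a $ j" "\<And>i. G i x \<le> b $ i" for a b x
    unfolding S_def using that by auto
  have "convex S"
  proof (rule convexI)
    fix y z :: "(real ^ 'r) \<times> (real ^ 'm)" and u v :: real
    assume "y \<in> S" "z \<in> S" and uv: "0 \<le> u" "0 \<le> v" "u + v = 1"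
    then obtain x1 x2 where x1: "\<And>j. P j x1 \<le> fst y $ j" "\<And>i. G i x1 \<le> snd y $ i"
      and x2: "\<And>j. P j x2 \<le> fst z $ j" "\<And>i. G i x2 \<le> snd z $ i"
      unfolding S_def by (auto simp: case_prod_beta)
    have comb: "f (u *\<^sub>R x1 + v *\<^sub>R x2) \<le> u * s + v * t"
      if "convex_on UNIV f" "f x1 \<le> s" "f x2 \<le> t" for f s t
    proof -
      have "f (u *\<^sub>R x1 + v *\<^sub>R x2) \<le> u * f x1 + v * f x2"
        using that(1) uv unfolding convex_on_def by blast
      also have "\<dots> \<le> u * s + v * t"
        using that uv by (intro add_mono mult_left_mono) auto
      finally show ?thesis .
    qed
    have "(u *\<^sub>R fst y + v *\<^sub>R fst z, u *\<^sub>R snd y + v *\<^sub>R snd z) \<in> S"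
      by (rule SI[where x = "u *\<^sub>R x1 + v *\<^sub>R x2"]) (simp_all add: comb P G x1 x2)
    then show "u *\<^sub>R y + v *\<^sub>R z \<in> S"
      by (simp add: scaleR_prod_def plus_prod_def)
  qed
  moreover have "closed S"
    unfolding closed_sequential_limits
  proof (intro allI impI)
    fix y l assume yl: "(\<forall>k. y k \<in> S) \<and> y \<longlonglongrightarrow> l"
    \<comment> \<open>Both families form one system over the sum type, solvable for each right-hand
      side \<open>y k\<close>.\<close>
    have "\<exists>x. \<forall>i\<in>UNIV. case_sum P G i x \<le> case_sum (\<lambda>j. fst l $ j) (\<lambda>i. snd l $ i) i"
    proof (rule convex_polynomial_system_closed[where
          c = "\<lambda>k. case_sum (\<lambda>j. fst (y k) $ j) (\<lambda>i. snd (y k) $ i)"])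
      fix i :: "'r + 'm"
      show "real_polynomial_function (case_sum P G i)" "convex_on UNIV (case_sum P G i)"
        using P G by (cases i; simp)+
      show "(\<lambda>k. case_sum (\<lambda>j. fst (y k) $ j) (\<lambda>i. snd (y k) $ i) i)
          \<longlonglongrightarrow> case_sum (\<lambda>j. fst l $ j) (\<lambda>i. snd l $ i) i"
        using yl by (cases i) (auto intro!: tendsto_vec_nth tendsto_fst tendsto_snd)
    next
      fix k
      from yl have "y k \<in> S"
        by blast
      then obtain x where "\<And>j. P j x \<le> fst (y k) $ j" "\<And>i. G i x \<le> snd (y k) $ i"
        unfolding S_def by (auto simp: case_prod_beta)
      then have "case_sum P G i x \<le> case_sum (\<lambda>j. fst (y k) $ j) (\<lambda>i. snd (y k) $ i) i" for i
        by (cases i) simp_all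
      then show "\<exists>x. \<forall>i\<in>UNIV. case_sum P G i x
          \<le> case_sum (\<lambda>j. fst (y k) $ j) (\<lambda>i. snd (y k) $ i) i"
        by blast
    qed simp
    then obtain x where
      x: "\<And>i. case_sum P G i x \<le> case_sum (\<lambda>j. fst l $ j) (\<lambda>i. snd l $ i) i"
      by blast
    have "(fst l, snd l) \<in> S"
    proof (rule SI)
      show "P j x \<le> fst l $ j" for j
        using x[of "Inl j"] by simp
      show "G i x \<le> snd l $ i" for i
        using x[of "Inr i"] by simp
    qed
    then show "l \<in> S"
      by simp
  qed
  moreover have "((\<chi> j. - e, 0) :: (real ^ 'r) \<times> (real ^ 'm)) \<notin> S"
  proof
    assume "((\<chi> j. - e, 0) :: (real ^ 'r) \<times> (real ^ 'm)) \<in> S"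
    then obtain x where x: "\<And>j. P j x \<le> - e" "\<And>i. G i x \<le> 0"
      unfolding S_def by auto
    obtain j where "0 \<le> P j x"
      using nonneg[OF x(2)] by (elim exE)
    with x(1)[of j] e show False
      by simp
  qed
  ultimately have "\<exists>c b. c \<bullet> (\<chi> j. - e, 0) < b \<and> (\<forall>y\<in>S. b < c \<bullet> y)"
    by (rule separating_hyperplane_closed_point)
  then obtain c :: "(real ^ 'r) \<times> (real ^ 'm)" and b where
    c: "c \<bullet> (\<chi> j. - e, 0) < b" "\<forall>y\<in>S. b < c \<bullet> y"
    by (elim exE conjE)
  \<comment> \<open>The two blocks of the separating normal are, up to scaling, the multipliers of
    \<open>P\<close> and \<open>G\<close>.\<close>
  define \<alpha> \<beta> where "\<alpha> = fst c" and "\<beta> = snd c"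
  have sep: "b < \<alpha> \<bullet> s + \<beta> \<bullet> t" if "\<And>j. P j x \<le> s $ j" "\<And>i. G i x \<le> t $ i" for s t x
    using bspec[OF c(2) SI[of x s t]] that by (simp add: inner_prod_def \<alpha>_def \<beta>_def)
  define T where "T = (\<Sum>j\<in>UNIV. \<alpha> $ j)"
  have "\<alpha> \<bullet> (\<chi> j. - e) + \<beta> \<bullet> 0 < b"
    using c(1) by (simp add: inner_prod_def \<alpha>_def \<beta>_def)
  moreover have "\<alpha> \<bullet> (\<chi> j. - e) = - (e * T)"
    by (simp add: inner_vec_def T_def sum_distrib_left sum_negf mult.commute)
  ultimately have b: "- (e * T) < b"
    by simp
  define vP vG where "vP x = (\<chi> j. P j x)" and "vG x = (\<chi> i. G i x)" for x
  \<comment> \<open>Raising coordinate \<open>j\<close> by any \<open>s \<ge> 0\<close> stays in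
    \<open>S\<close>, where the functional is bounded below by \<open>b\<close>.\<close>
  have \<alpha>: "0 \<le> \<alpha> $ j" for j
  proof (rule nonneg_of_affine_lower_bound)
    fix s :: real assume s: "0 \<le> s"
    have "b < \<alpha> \<bullet> (vP x0 + s *\<^sub>R axis j 1) + \<beta> \<bullet> vG x0"
      by (rule sep[where x = x0]) (use s in \<open>simp_all add: vP_def vG_def axis_def\<close>)
    then show "b < \<alpha> \<bullet> vP x0 + \<beta> \<bullet> vG x0 + s * \<alpha> $ j"
      by (simp add: inner_add_right inner_axis)
  qed
  have \<beta>: "0 \<le> \<beta> $ i" for i
  proof (rule nonneg_of_affine_lower_bound)
    fix s :: real assume s: "0 \<le> s"
    have "b < \<alpha> \<bullet> vP x0 + \<beta> \<bullet> (vG x0 + s *\<^sub>R axis i 1)"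
      by (rule sep[where x = x0]) (use s in \<open>simp_all add: vP_def vG_def axis_def\<close>)
    then show "b < \<alpha> \<bullet> vP x0 + \<beta> \<bullet> vG x0 + s * \<beta> $ i"
      by (simp add: inner_add_right inner_axis)
  qed
  have pos: "0 < (\<Sum>j\<in>UNIV. \<alpha> $ j * P j x) + (\<Sum>i\<in>UNIV. \<beta> $ i * G i x) + e * T" for x
  proof -
    have "b < \<alpha> \<bullet> vP x + \<beta> \<bullet> vG x"
      by (rule sep[where x = x]) (simp_all add: vP_def vG_def)
    then show ?thesis
      using b by (simp add: inner_vec_def vP_def vG_def)
  qed
  \<comment> \<open>If \<open>T = 0\<close>, then \<alpha> vanishes, and \<open>pos\<close> at the
    feasible point \<open>x0\<close> would make a sum of nonpositive terms positive.\<close>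
  have "T \<noteq> 0"
  proof
    assume T: "T = 0"
    then have "\<alpha> $ j = 0" for j
      unfolding T_def using \<alpha> by (simp add: sum_nonneg_eq_0_iff)
    moreover have "(\<Sum>i\<in>UNIV. \<beta> $ i * G i x0) \<le> 0"
      using \<beta> feasible by (intro sum_nonpos mult_nonneg_nonpos)
    ultimately show False
      using pos[of x0] T by simp
  qed
  moreover have "T \<ge> 0"
    unfolding T_def by (intro sum_nonneg \<alpha>)
  ultimately have T: "T > 0"
    by simp
  \<comment> \<open>Division by \<open>T\<close> moves \<alpha> into the simplex and turns
    \<open>e * T\<close> into \<open>e\<close>.\<close>
  show ?thesis
  proof (intro bexI allI)
    fix x
    have "(\<Sum>j\<in>UNIV. ((1 / T) *\<^sub>R \<alpha>) $ j * P j x) + (\<Sum>i\<in>UNIV. ((1 / T) *\<^sub>R \<beta>) $ i * G i x) + e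
        = ((\<Sum>j\<in>UNIV. \<alpha> $ j * P j x) + (\<Sum>i\<in>UNIV. \<beta> $ i * G i x) + e * T) / T"
      using T by (simp add: add_divide_distrib sum_divide_distrib)
    then show "0 < (\<Sum>j\<in>UNIV. ((1 / T) *\<^sub>R \<alpha>) $ j * P j x)
        + (\<Sum>i\<in>UNIV. ((1 / T) *\<^sub>R \<beta>) $ i * G i x) + e"
      using pos[of x] T by simp
    show "(1 / T) *\<^sub>R \<beta> \<in> nonneg_orthant"
      using \<beta> T by (simp add: nonneg_orthant_def)
    show "(1 / T) *\<^sub>R \<alpha> \<in> unit_simplex"
      using \<alpha> T by (simp add: unit_simplex_def nonneg_orthant_def T_def flip: sum_divide_distrib)
  qed
qed

section \<open>Approximate certificates for nonnegativity of the maximum\<close>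

theorem theorem2p5:
  fixes p :: "'r::finite \<Rightarrow> ('n::finite) rpoly"
    and g :: "'m::finite \<Rightarrow> 'n rpoly"
    and d :: nat
  assumes p_sos_convex: "\<And>j. sos_convex (p j)"
    and g_sos_convex: "\<And>i. sos_convex (g i)"
    and feasible: "{x :: real ^ 'n. \<forall>i. eval_rpoly (g i) x \<le> 0} \<noteq> {}"
    and d_def: "d = (LEAST k. even k \<and> max (MAX j. deg_rpoly (p j)) (MAX i. deg_rpoly (g i)) \<le> k)"
  shows "(\<forall>x :: real ^ 'n. (\<forall>i. eval_rpoly (g i) x \<le> 0) \<longrightarrow> 0 \<le> (MAX j. eval_rpoly (p j) x))
     \<longleftrightarrow>
     (\<forall>\<epsilon>::real. \<epsilon> > 0 \<longrightarrow>
       (\<exists>\<delta> \<in> (unit_simplex :: (real ^ 'r) set). \<exists>lam \<in> (nonneg_orthant :: (real ^ 'm) set).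
         \<exists>\<sigma> \<in> (sos_deg_le d :: 'n rpoly set).
           (\<Sum>j\<in>UNIV. const_rpoly (\<delta> $ j) * p j) + (\<Sum>i\<in>UNIV. const_rpoly (lam $ i) * g i)
             + const_rpoly \<epsilon> = \<sigma>))"
proof (intro iffI allI impI)
  fix x :: "real ^ 'n"
  assume rep: "\<forall>\<epsilon>::real. \<epsilon> > 0 \<longrightarrow>
       (\<exists>\<delta> \<in> (unit_simplex :: (real ^ 'r) set). \<exists>lam \<in> (nonneg_orthant :: (real ^ 'm) set).
         \<exists>\<sigma> \<in> (sos_deg_le d :: 'n rpoly set).
           (\<Sum>j\<in>UNIV. const_rpoly (\<delta> $ j) * p j) + (\<Sum>i\<in>UNIV. const_rpoly (lam $ i) * g i)
             + const_rpoly \<epsilon> = \<sigma>)"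
    and x: "\<forall>i. eval_rpoly (g i) x \<le> 0"
  let ?M = "MAX j. eval_rpoly (p j) x"
  \<comment> \<open>The certificate is evaluated at the feasible point \<open>x\<close>: \<sigma> is
    nonnegative, the part with the \<open>g i\<close> is nonpositive, and a simplex average of the
    \<open>p j\<close> is at most their maximum.\<close>
  have "0 \<le> ?M + \<epsilon>" if \<epsilon>: "\<epsilon> > 0" for \<epsilon>
  proof -
    obtain \<delta> :: "real ^ 'r" and lam :: "real ^ 'm" and \<sigma> :: "'n rpoly"
      where \<delta>: "\<delta> \<in> unit_simplex" and lam: "lam \<in> nonneg_orthant" and \<sigma>: "\<sigma> \<in> sos_deg_le d"
        and eq: "(\<Sum>j\<in>UNIV. const_rpoly (\<delta> $ j) * p j) + (\<Sum>i\<in>UNIV. const_rpoly (lam $ i) * g i)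
             + const_rpoly \<epsilon> = \<sigma>"
      using rep[rule_format, OF \<epsilon>] by (elim bexE)
    have "0 \<le> eval_rpoly \<sigma> x"
      using \<sigma> by (simp add: sos_deg_le_def sos_nonneg)
    also have "\<dots> = (\<Sum>j\<in>UNIV. \<delta> $ j * eval_rpoly (p j) x) + (\<Sum>i\<in>UNIV. lam $ i * eval_rpoly (g i) x) + \<epsilon>"
      unfolding eq[symmetric] by simp
    also have "(\<Sum>i\<in>UNIV. lam $ i * eval_rpoly (g i) x) \<le> 0"
      using lam x by (intro sum_nonpos mult_nonneg_nonpos) (auto simp: nonneg_orthant_def)
    also have "(\<Sum>j\<in>UNIV. \<delta> $ j * eval_rpoly (p j) x) \<le> (\<Sum>j\<in>UNIV. \<delta> $ j * ?M)"
      using \<delta> by (intro sum_mono mult_left_mono Max_ge) (auto simp: unit_simplex_def nonneg_orthant_def)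
    also have "\<dots> = ?M"
      using \<delta> by (simp add: unit_simplex_def flip: sum_distrib_right)
    finally show ?thesis
      by simp
  qed
  then show "0 \<le> ?M"
    by (rule field_le_epsilon)
next
  fix \<epsilon> :: real
  assume nonneg: "\<forall>x :: real ^ 'n. (\<forall>i. eval_rpoly (g i) x \<le> 0) \<longrightarrow> 0 \<le> (MAX j. eval_rpoly (p j) x)"
    and \<epsilon>: "\<epsilon> > 0"
  obtain x0 :: "real ^ 'n" where x0: "\<And>i. eval_rpoly (g i) x0 \<le> 0"
    using feasible by auto
  have "\<exists>\<delta>\<in>(unit_simplex :: (real ^ 'r) set). \<exists>lam\<in>(nonneg_orthant :: (real ^ 'm) set).
    \<forall>x. 0 < (\<Sum>j\<in>UNIV. \<delta> $ j * eval_rpoly (p j) x) + (\<Sum>i\<in>UNIV. lam $ i * eval_rpoly (g i) x) + \<epsilon>"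
  proof (rule convex_polynomial_alternative)
    fix x assume "\<And>i. eval_rpoly (g i) x \<le> 0"
    then have "0 \<le> (MAX j. eval_rpoly (p j) x)"
      using nonneg by simp
    then show "\<exists>j. 0 \<le> eval_rpoly (p j) x"
      by (subst (asm) Max_ge_iff) auto
  qed (rule real_polynomial_function_eval_rpoly sos_convex_imp_convex_on p_sos_convex g_sos_convex x0 \<epsilon>)+
  then obtain \<delta> :: "real ^ 'r" and lam :: "real ^ 'm"
    where \<delta>: "\<delta> \<in> unit_simplex" and lam: "lam \<in> nonneg_orthant"
      and pos: "\<forall>x. 0 < (\<Sum>j\<in>UNIV. \<delta> $ j * eval_rpoly (p j) x) + (\<Sum>i\<in>UNIV. lam $ i * eval_rpoly (g i) x) + \<epsilon>"
    by (elim bexE)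
  let ?L = "(\<Sum>j\<in>UNIV. const_rpoly (\<delta> $ j) * p j) + (\<Sum>i\<in>UNIV. const_rpoly (lam $ i) * g i)
    + const_rpoly \<epsilon>"
  \<comment> \<open>Objectives and constraints are merged into one family over the sum type, so that
    a single nonnegative combination covers both.\<close>
  define q where "q = case_sum p g"
  define w where "w = case_sum (\<lambda>j. \<delta> $ j) (\<lambda>i. lam $ i)"
  have split: "(\<Sum>k\<in>UNIV. h k) = (\<Sum>j\<in>UNIV. h (Inl j)) + (\<Sum>i\<in>UNIV. h (Inr i))"
    for h :: "'r + 'm \<Rightarrow> 'b::comm_monoid_add"
    by (subst UNIV_Plus_UNIV[symmetric], subst sum.Plus) simp_all
  have "sos ((\<Sum>k\<in>UNIV. const_rpoly (w k) * q k) + const_rpoly \<epsilon>)"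
  proof (rule nonneg_combination_sos)
    fix k :: "'r + 'm"
    show "sos_convex (q k)"
      by (cases k) (simp_all add: q_def p_sos_convex g_sos_convex)
    show "0 \<le> w k"
      using \<delta> lam by (cases k) (simp_all add: w_def unit_simplex_def nonneg_orthant_def)
  next
    fix x
    show "0 \<le> (\<Sum>k\<in>UNIV. w k * eval_rpoly (q k) x) + \<epsilon>"
      using pos[rule_format, of x] unfolding split by (simp add: w_def q_def)
  qed
  then have "sos ?L"
    unfolding split by (simp add: w_def q_def)
  moreover have "deg_rpoly ?L \<le> d"
  proof -
    let ?D = "max (MAX j. deg_rpoly (p j)) (MAX i. deg_rpoly (g i))"
    \<comment> \<open>An even bound on the degrees exists, so the least one, \<open>d\<close>, is
      itself such a bound.\<close>
    have "even (2 * ?D) \<and> ?D \<le> 2 * ?D"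
      by (simp only: mult_2 le_add1 even_add simp_thms)
    then have "?D \<le> d"
      unfolding d_def by (rule LeastI2) blast
    moreover have "deg_rpoly (p j) \<le> (MAX j. deg_rpoly (p j))" for j
      by (rule Max_ge) auto
    moreover have "deg_rpoly (g i) \<le> (MAX i. deg_rpoly (g i))" for i
      by (rule Max_ge) auto
    ultimately have "deg_rpoly (p j) \<le> d" "deg_rpoly (g i) \<le> d" for i j
      by (meson le_trans max.bounded_iff)+
    then show ?thesis
      by (intro deg_rpoly_add_le deg_rpoly_sum_le deg_rpoly_const_mult_le) simp_all
  qed
  ultimately have "?L \<in> sos_deg_le d"
    by (simp add: sos_deg_le_def)
  with \<delta> lam show "\<exists>\<delta> \<in> (unit_simplex :: (real ^ 'r) set). \<exists>lam \<in> (nonneg_orthant :: (real ^ 'm) set).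
         \<exists>\<sigma> \<in> (sos_deg_le d :: 'n rpoly set).
           (\<Sum>j\<in>UNIV. const_rpoly (\<delta> $ j) * p j) + (\<Sum>i\<in>UNIV. const_rpoly (lam $ i) * g i)
             + const_rpoly \<epsilon> = \<sigma>"
    by (intro bexI[of _ \<delta>] bexI[of _ lam] bexI[of _ ?L] refl)
qed

end
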